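(* Let $L>0$ and $\Omega=(0,L)\subset\mathbb{R}$. Then, as $t\to0^+$, $$Z_\Omega(t)=\frac{L}{\sqrt{4\pi t}}-\frac12+o(1).$$
   Context: $Z_\Omega(t)=\mathrm{Tr}(e^{t\Delta_D})=\int_\Omega p_t(x,x)\,dx$ is the Dirichlet partition function, where $\Delta_D$ is the Dirichlet Laplacian on $\Omega$ and $p_t(x,y)$ is the Dirichlet heat kernel of $\partial_t u=\Delta u$ on $\Omega$. *)

theory Defs
  imports "HOL-Analysis.Analysis" "HOL-Library.Landau_Symbols"
begin

text \<open>
  Throughout, \<open>\<Omega>\<close> is meant to be a bounded open subset of the real line, so that the Laplacian
  is the second derivative and the classical Dirichlet problem for the heat equation is well posed.
\<close>

definition dirichlet_heat_solution ::
    "real set \<Rightarrow> (real \<Rightarrow> real) \<Rightarrow> (real \<Rightarrow> real \<Rightarrow> real) \<Rightarrow> bool" where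
  "dirichlet_heat_solution \<Omega> f u \<longleftrightarrow>
     continuous_on ({0..} \<times> closure \<Omega>) (\<lambda>(t, x). u t x) \<and>
     (\<forall>x\<in>closure \<Omega>. u 0 x = f x) \<and>
     (\<forall>t\<ge>0. \<forall>x\<in>frontier \<Omega>. u t x = 0) \<and>
     (\<exists>u\<^sub>t u\<^sub>x u\<^sub>x\<^sub>x. \<forall>t>0. \<forall>x\<in>\<Omega>.
        ((\<lambda>s. u s x) has_real_derivative u\<^sub>t t x) (at t) \<and>
        (u t has_real_derivative u\<^sub>x t x) (at x) \<and>
        (u\<^sub>x t has_real_derivative u\<^sub>x\<^sub>x t x) (at x) \<and>
        u\<^sub>t t x = u\<^sub>x\<^sub>x t x)"

text \<open>
  The Dirichlet heat kernel is the continuous integral kernel of the solution operator, i.e.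
  \<open>(e\<^sup>t\<^sup>\<Delta> f) x = (\<integral>y\<in>\<Omega>. p t x y * f y)\<close> for all \<open>f\<close> continuous on the closure and vanishing on the
  boundary. The first conjunct fixes the values outside \<open>t > 0\<close>, \<open>x, y \<in> \<Omega>\<close>, where the kernel has no
  meaning, so that it is unique as a total function; together with the second one it makes the
  kernel vanish continuously at the boundary.
\<close>

definition is_dirichlet_heat_kernel ::
    "real set \<Rightarrow> (real \<Rightarrow> real \<Rightarrow> real \<Rightarrow> real) \<Rightarrow> bool" where
  "is_dirichlet_heat_kernel \<Omega> p \<longleftrightarrow>
     (\<forall>t x y. \<not> (t > 0 \<and> x \<in> \<Omega> \<and> y \<in> \<Omega>) \<longrightarrow> p t x y = 0) \<and>
     continuous_on ({0<..} \<times> closure \<Omega> \<times> closure \<Omega>) (\<lambda>(t, x, y). p t x y) \<and>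
     (\<forall>f. continuous_on (closure \<Omega>) f \<and> (\<forall>x\<in>frontier \<Omega>. f x = 0) \<longrightarrow>
        dirichlet_heat_solution \<Omega> f
          (\<lambda>t x. if t = 0 then f x else (LINT y:\<Omega>|lborel. p t x y * f y)))"

definition dirichlet_heat_kernel :: "real set \<Rightarrow> real \<Rightarrow> real \<Rightarrow> real \<Rightarrow> real" where
  "dirichlet_heat_kernel \<Omega> = (THE p. is_dirichlet_heat_kernel \<Omega> p)"

definition dirichlet_partition_function :: "real set \<Rightarrow> real \<Rightarrow> real" where
  "dirichlet_partition_function \<Omega> t = (LINT x:\<Omega>|lborel. dirichlet_heat_kernel \<Omega> t x x)"

end

(* The kernel is built by the method of images: extending the initial datum to an odd function
   of period 2L turns the Dirichlet problem on (0,L) into the heat equation on the whole line, so the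
   kernel is theta(x - y) - theta(x + y), with theta the 2L-periodization of the Gaussian.  The weak
   maximum principle makes the Dirichlet solution, hence the kernel, unique.  On the diagonal the
   first term contributes L * theta(0), where only the unshifted Gaussian survives as t tends to 0,
   and the second one unfolds to minus the integral of a rescaled Gaussian over the line,
   which is exactly -1/2. *)

theory Submission
  imports Defs "HOL-Probability.Distributions" "HOL-Real_Asymp.Real_Asymp"
begin

text \<open>The kernel is given by a definite description, so exhibiting the image kernel is not
  enough: it has to be the only candidate before its formula may replace the description. The
  obstacle on the existence side is that no single formula shows everything. Convolution of the
  Gaussian with the odd extension can be differentiated by dominated convergence, but it is singular
  at \<open>t = 0\<close>. Averaging the extension at \<open>x + sqrt (2 * t) * w\<close> against
  the standard normal density makes sense at \<open>t = 0\<close> and gives continuity up to the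
  initial time. The integral over the interval is the form that the definition asks for. The three
  are shown to be the same function, so theta is never differentiated term by term. The passage from
  the line to the interval uses finite windows whose folded integrals are exactly partial theta
  sums; what remains are limits of integrals of continuous functions.\<close>

section \<open>Uniqueness of the Dirichlet heat kernel\<close>

text \<open>\<open>w - e * t\<close> is a strict subsolution, so at a positive maximum the first order condition in
  \<open>t\<close> would give \<open>w\<^sub>x\<^sub>x \<ge> e > 0\<close>, against the second order condition in \<open>x\<close>.\<close>

lemma heat_weak_maximum_principle:
  fixes w w\<^sub>t w\<^sub>x w\<^sub>x\<^sub>x :: "real \<Rightarrow> real \<Rightarrow> real"
  assumes cont: "continuous_on ({0..T} \<times> {a..b}) (\<lambda>(t, x). w t x)"
    and init: "\<And>x. x \<in> {a..b} \<Longrightarrow> w 0 x \<le> 0"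
    and bdry: "\<And>t. t \<in> {0..T} \<Longrightarrow> w t a \<le> 0 \<and> w t b \<le> 0"
    and dt: "\<And>t x. t > 0 \<Longrightarrow> a < x \<Longrightarrow> x < b \<Longrightarrow> ((\<lambda>s. w s x) has_real_derivative w\<^sub>t t x) (at t)"
    and dx: "\<And>t x. t > 0 \<Longrightarrow> a < x \<Longrightarrow> x < b \<Longrightarrow> (w t has_real_derivative w\<^sub>x t x) (at x)"
    and dxx: "\<And>t x. t > 0 \<Longrightarrow> a < x \<Longrightarrow> x < b \<Longrightarrow> (w\<^sub>x t has_real_derivative w\<^sub>x\<^sub>x t x) (at x)"
    and heat: "\<And>t x. t > 0 \<Longrightarrow> a < x \<Longrightarrow> x < b \<Longrightarrow> w\<^sub>t t x = w\<^sub>x\<^sub>x t x"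
    and x: "x \<in> {a..b}" and T: "0 \<le> T"
  shows "w T x \<le> 0"
proof (rule ccontr)
  assume "\<not> w T x \<le> 0"
  then have pos: "w T x > 0" by simp
  have "T > 0" using pos init[OF x] T by (cases "T = 0") auto
  \<comment> \<open>The penalty \<open>e * t\<close> then takes away exactly half of
    \<open>w T x\<close> at time \<open>T\<close>, so the maximum of \<open>v\<close> is still
    positive.\<close>
  define e where "e = w T x / (2 * T)"
  have e: "e > 0" using pos \<open>T > 0\<close> by (simp add: e_def)
  define v where "v = (\<lambda>(t, x). w t x - e * t)"
  have "continuous_on ({0..T} \<times> {a..b}) v"
    using cont unfolding v_def case_prod_unfold by (intro continuous_intros)
  moreover have "compact ({0..T} \<times> {a..b})" by (intro compact_Times) auto
  moreover have "{0..T} \<times> {a..b} \<noteq> {}" using T x by auto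
  ultimately obtain p where p: "p \<in> {0..T} \<times> {a..b}"
    and vmax: "\<forall>q\<in>{0..T} \<times> {a..b}. v q \<le> v p"
    by (metis continuous_attains_sup)
  obtain s y where sy: "p = (s, y)" by (cases p)
  have s: "0 \<le> s" "s \<le> T" and y: "a \<le> y" "y \<le> b" using p sy by auto
  have "v (T, x) \<le> v p" using vmax x T by auto
  moreover have "v (T, x) = w T x / 2" using \<open>T > 0\<close> by (simp add: v_def e_def)
  ultimately have vp: "w s y - e * s > 0" using pos by (simp add: sy v_def)
  have es: "e * s \<ge> 0" using e s by simp
  have "s \<noteq> 0" using vp init[of y] y by auto
  then have s0: "s > 0" using s by simp
  \<comment> \<open>At a positive maximum of \<open>v\<close>, \<open>w\<close> exceeds
    \<open>e * s\<close>, which is nonnegative; this excludes the lateral boundary, as it excluded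
    the initial time.\<close>
  have ya: "y \<noteq> a" and yb: "y \<noteq> b" using vp es bdry[of s] s by force+
  then have y': "a < y" "y < b" using y by auto
  have wx0: "w\<^sub>x s y = 0"
  proof (rule DERIV_local_max[OF dx[OF s0 y'], of "min (y - a) (b - y)"])
    show "0 < min (y - a) (b - y)" using y' by simp
    show "\<forall>z. \<bar>y - z\<bar> < min (y - a) (b - y) \<longrightarrow> w s z \<le> w s y"
    proof (intro allI impI)
      fix z assume "\<bar>y - z\<bar> < min (y - a) (b - y)"
      then have "z \<in> {a..b}" by auto
      then have "v (s, z) \<le> v p" using vmax s by auto
      then show "w s z \<le> w s y" by (simp add: v_def sy)
    qed
  qed
  \<comment> \<open>The maximum may sit at the final time \<open>s = T\<close>, so only earlier
    times are available for comparison; they give an inequality instead of a vanishing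
    derivative.\<close>
  have "w\<^sub>t s y \<ge> e"
  proof (rule ccontr)
    assume "\<not> w\<^sub>t s y \<ge> e"
    then have "w\<^sub>t s y - e < 0" by simp
    moreover have "((\<lambda>s. w s y - e * s) has_real_derivative (w\<^sub>t s y - e)) (at s)"
      using dt[OF s0 y'] by (auto intro!: derivative_eq_intros)
    ultimately obtain d where d: "d > 0"
      and dec: "\<And>h. 0 < h \<Longrightarrow> h < d \<Longrightarrow> w s y - e * s < w (s - h) y - e * (s - h)"
      using DERIV_neg_dec_left by blast
    define h where "h = min s (d/2)"
    have h: "0 < h" "h < d" "h \<le> s" using d s0 by (auto simp: h_def)
    have "v (s - h, y) \<le> v p" using vmax h s y by auto
    with dec[OF h(1,2)] show False by (simp add: v_def sy)
  qed
  \<comment> \<open>A critical point with positive second derivative: \<open>w\<^sub>x\<close>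
    becomes positive immediately to the right of \<open>y\<close>, so \<open>w s\<close> increases
    there and \<open>y\<close> is not a spatial maximum.\<close>
  then have "w\<^sub>x\<^sub>x s y > 0" using heat[OF s0 y'] e by simp
  then obtain d where d: "d > 0" and inc: "\<And>h. 0 < h \<Longrightarrow> h < d \<Longrightarrow> w\<^sub>x s y < w\<^sub>x s (y + h)"
    using DERIV_pos_inc_right[OF dxx[OF s0 y']] by blast
  obtain z where z: "y < z" "z < b" "z < y + d"
    using dense[of y "min b (y + d)"] d y' by auto
  have "w s y < w s z"
  proof (rule DERIV_pos_imp_increasing_open[OF z(1)])
    fix r assume r: "y < r" "r < z"
    have "w\<^sub>x s y < w\<^sub>x s (y + (r - y))" using inc[of "r - y"] r z by auto
    then have "w\<^sub>x s r > 0" using wx0 by simp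
    then show "\<exists>D. (w s has_real_derivative D) (at r) \<and> 0 < D"
      using dx[OF s0, of r] r z y' by auto
  next
    have "\<And>r. r \<in> {y..z} \<Longrightarrow> isCont (w s) r"
      using DERIV_isCont[OF dx[OF s0]] z y' by auto
    then show "continuous_on {y..z} (w s)" by (simp add: continuous_at_imp_continuous_on)
  qed
  moreover have "v (s, z) \<le> v p" using vmax s z y' by auto
  ultimately show False by (simp add: v_def sy)
qed

lemma dirichlet_heat_solution_diff:
  assumes "dirichlet_heat_solution \<Omega> f u" "dirichlet_heat_solution \<Omega> f v"
  shows "dirichlet_heat_solution \<Omega> (\<lambda>_. 0) (\<lambda>t x. u t x - v t x)"
proof -
  obtain u1 u2 u3 where u: "\<forall>t>0. \<forall>x\<in>\<Omega>. ((\<lambda>s. u s x) has_real_derivative u1 t x) (at t) \<and>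
        (u t has_real_derivative u2 t x) (at x) \<and>
        (u2 t has_real_derivative u3 t x) (at x) \<and> u1 t x = u3 t x"
    using assms(1) unfolding dirichlet_heat_solution_def by blast
  obtain v1 v2 v3 where v: "\<forall>t>0. \<forall>x\<in>\<Omega>. ((\<lambda>s. v s x) has_real_derivative v1 t x) (at t) \<and>
        (v t has_real_derivative v2 t x) (at x) \<and>
        (v2 t has_real_derivative v3 t x) (at x) \<and> v1 t x = v3 t x"
    using assms(2) unfolding dirichlet_heat_solution_def by blast
  have "\<forall>t>0. \<forall>x\<in>\<Omega>. ((\<lambda>s. u s x - v s x) has_real_derivative u1 t x - v1 t x) (at t) \<and>
        ((\<lambda>x. u t x - v t x) has_real_derivative u2 t x - v2 t x) (at x) \<and>
        ((\<lambda>x. u2 t x - v2 t x) has_real_derivative u3 t x - v3 t x) (at x) \<and> 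
        u1 t x - v1 t x = u3 t x - v3 t x"
  proof (intro allI impI ballI)
    fix t :: real and x assume "t > 0" "x \<in> \<Omega>"
    with u v have *: "((\<lambda>s. u s x) has_real_derivative u1 t x) (at t)" "((\<lambda>s. v s x) has_real_derivative v1 t x) (at t)"
      "(u t has_real_derivative u2 t x) (at x)" "(v t has_real_derivative v2 t x) (at x)"
      "(u2 t has_real_derivative u3 t x) (at x)" "(v2 t has_real_derivative v3 t x) (at x)"
      "u1 t x = u3 t x" "v1 t x = v3 t x" by blast+
    show "((\<lambda>s. u s x - v s x) has_real_derivative u1 t x - v1 t x) (at t) \<and>
        ((\<lambda>x. u t x - v t x) has_real_derivative u2 t x - v2 t x) (at x) \<and>
        ((\<lambda>x. u2 t x - v2 t x) has_real_derivative u3 t x - v3 t x) (at x) \<and>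
        u1 t x - v1 t x = u3 t x - v3 t x"
      using DERIV_diff[OF *(1,2)] DERIV_diff[OF *(3,4)] DERIV_diff[OF *(5,6)] *(7,8) by simp
  qed
  then have ex: "\<exists>w1 w2 w3. \<forall>t>0. \<forall>x\<in>\<Omega>. ((\<lambda>s. u s x - v s x) has_real_derivative w1 t x) (at t) \<and>
        ((\<lambda>x. u t x - v t x) has_real_derivative w2 t x) (at x) \<and>
        (w2 t has_real_derivative w3 t x) (at x) \<and> 
        w1 t x = w3 t x"
    by (intro exI[of _ "\<lambda>t x. u1 t x - v1 t x"] exI[of _ "\<lambda>t x. u2 t x - v2 t x"]
        exI[of _ "\<lambda>t x. u3 t x - v3 t x"])
  have "continuous_on ({0..} \<times> closure \<Omega>) (\<lambda>(t, x). u t x - v t x)"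
    using assms unfolding dirichlet_heat_solution_def case_prod_unfold
    by (intro continuous_intros) auto
  with ex assms show ?thesis unfolding dirichlet_heat_solution_def by simp
qed

text \<open>The difference has zero initial and boundary values, so the maximum principle bounds it
  above by 0; exchanging the two solutions gives the reverse inequality.\<close>

lemma dirichlet_heat_solution_unique:
  assumes ab: "a < b"
    and u: "dirichlet_heat_solution {a<..<b} f u" and v: "dirichlet_heat_solution {a<..<b} f v"
    and t: "t \<ge> 0" and x: "x \<in> {a..b}"
  shows "u t x = v t x"
proof -
  have le: "u t x \<le> v t x"
    if u: "dirichlet_heat_solution {a<..<b} f u" and v: "dirichlet_heat_solution {a<..<b} f v" for u v
  proof -
    define w where "w = (\<lambda>t x. u t x - v t x)"
    have sol: "dirichlet_heat_solution {a<..<b} (\<lambda>_. 0) w"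
      unfolding w_def by (rule dirichlet_heat_solution_diff[OF u v])
    have cl: "closure {a<..<b} = {a..b}" using ab by simp
    have fr: "frontier {a<..<b} = {a, b}" using ab by (auto simp: frontier_def)
    obtain w1 w2 w3 where w: "\<forall>t>0. \<forall>x\<in>{a<..<b}. ((\<lambda>s. w s x) has_real_derivative w1 t x) (at t) \<and>
        (w t has_real_derivative w2 t x) (at x) \<and>
        (w2 t has_real_derivative w3 t x) (at x) \<and> w1 t x = w3 t x"
      using sol unfolding dirichlet_heat_solution_def by blast
    then have w': "((\<lambda>s. w s x) has_real_derivative w1 t x) (at t)"
        "(w t has_real_derivative w2 t x) (at x)"
        "(w2 t has_real_derivative w3 t x) (at x)" "w1 t x = w3 t x"
      if "t > 0" "a < x" "x < b" for t x
      using that by (meson greaterThanLessThan_iff)+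
    have "w t x \<le> 0"
    proof (rule heat_weak_maximum_principle[of t a b w w1 w2 w3])
      have "continuous_on ({0..} \<times> {a..b}) (\<lambda>(t, x). w t x)"
        using sol unfolding dirichlet_heat_solution_def cl by blast
      then show "continuous_on ({0..t} \<times> {a..b}) (\<lambda>(t, x). w t x)"
        by (rule continuous_on_subset) auto
      show "w 0 x \<le> 0" if "x \<in> {a..b}" for x
        using sol that unfolding dirichlet_heat_solution_def cl by simp
      show "w t a \<le> 0 \<and> w t b \<le> 0" if "t \<in> {0..t'}" for t t'
        using sol that unfolding dirichlet_heat_solution_def fr by simp
    qed (assumption | rule w' x t)+
    then show ?thesis by (simp add: w_def)
  qed
  from le[OF u v] le[OF v u] show ?thesis by simp
qed

text \<open>For fixed \<open>t\<close> and \<open>x\<close>, the difference of the two kernels as a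
  function of \<open>y\<close> serves as its own initial datum. Both kernels must produce the same
  solution from it, and equality at \<open>(t, x)\<close> says that the integral of its square is 0;
  continuity then makes it vanish pointwise.\<close>

lemma is_dirichlet_heat_kernel_unique:
  assumes ab: "a < b"
    and p: "is_dirichlet_heat_kernel {a<..<b} p" and q: "is_dirichlet_heat_kernel {a<..<b} q"
  shows "p = q"
proof (intro ext)
  fix t x y
  have cl: "closure {a<..<b} = {a..b}" using ab by simp
  have fr: "frontier {a<..<b} = {a, b}" using ab by (auto simp: frontier_def)
  show "p t x y = q t x y"
  proof (cases "t > 0 \<and> x \<in> {a<..<b} \<and> y \<in> {a<..<b}")
    case False
    then show ?thesis using p q unfolding is_dirichlet_heat_kernel_def by metis
  next
    case True
    then have t: "t > 0" and x: "x \<in> {a<..<b}" and y: "y \<in> {a<..<b}" by auto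
    have sec: "continuous_on {a..b} (r t x)" if "is_dirichlet_heat_kernel {a<..<b} r" for r
    proof -
      have "continuous_on ({0<..} \<times> {a..b} \<times> {a..b}) (\<lambda>(t, x, y). r t x y)"
        using that unfolding is_dirichlet_heat_kernel_def cl by blast
      then have "continuous_on {a..b} (\<lambda>y. (\<lambda>(t, x, y). r t x y) (t, x, y))"
        by (rule continuous_on_compose2) (use t x in \<open>auto intro!: continuous_intros\<close>)
      then show ?thesis by simp
    qed
    define f where "f = (\<lambda>y. p t x y - q t x y)"
    have f: "continuous_on {a..b} f" unfolding f_def
      by (intro continuous_intros sec p q)
    \<comment> \<open>Admissibility of \<open>f\<close> as a datum: endpoints lie outside the open
      interval, where both kernels are 0 by normalization.\<close>
    have f0: "\<forall>x\<in>frontier {a<..<b}. f x = 0"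
      using p q unfolding is_dirichlet_heat_kernel_def fr f_def by simp
    have int: "set_integrable lborel {a<..<b} (\<lambda>y. g y * f y)" if "continuous_on {a..b} g" for g
    proof (rule set_integrable_subset)
      show "set_integrable lborel {a..b} (\<lambda>y. g y * f y)"
        unfolding set_integrable_def by (rule borel_integrable_compact) (auto intro!: continuous_intros f that)
    qed auto
    have "(LINT y:{a<..<b}|lborel. p t x y * f y) = (LINT y:{a<..<b}|lborel. q t x y * f y)"
    proof -
      have "\<And>r. is_dirichlet_heat_kernel {a<..<b} r \<Longrightarrow> dirichlet_heat_solution {a<..<b} f
          (\<lambda>t x. if t = 0 then f x else (LINT y:{a<..<b}|lborel. r t x y * f y))"
        using f f0 unfolding is_dirichlet_heat_kernel_def cl by blast
      from dirichlet_heat_solution_unique[OF ab this[OF p] this[OF q], of t x] t x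
      show ?thesis by simp
    qed
    then have "(LINT y:{a<..<b}|lborel. p t x y * f y - q t x y * f y) = 0"
      using int[OF sec[OF p]] int[OF sec[OF q]] by (simp add: set_integral_diff)
    then have "(LINT y:{a<..<b}|lborel. f y * f y) = 0"
      by (simp add: f_def left_diff_distrib)
    then have "integral {a..b} (\<lambda>y. f y * f y) = 0"
      using set_borel_integral_eq_integral(2)[OF int[OF f]] by (simp add: integral_open_interval_real)
    moreover have "(\<lambda>y. f y * f y) integrable_on {a..b}"
      by (intro integrable_continuous_real continuous_intros f)
    ultimately have "((\<lambda>y. f y * f y) has_integral 0) (cbox a b)"
      by (metis box_real(2) integrable_integral)
    then have "f y * f y = 0"
      by (rule has_integral_0_cbox_imp_0[rotated 2]) (use y in \<open>auto intro!: continuous_intros f\<close>)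
    then show ?thesis by (simp add: f_def)
  qed
qed

section \<open>Differentiation under the integral sign\<close>

lemma leibniz_rule_dominated:
  fixes g g' :: "real \<Rightarrow> 'a \<Rightarrow> real"
  assumes d: "d > 0"
    and int: "\<And>s. \<bar>s - x\<bar> < d \<Longrightarrow> integrable M (g s)"
    and deriv: "\<And>s z. \<bar>s - x\<bar> < d \<Longrightarrow> z \<in> space M \<Longrightarrow> ((\<lambda>s. g s z) has_real_derivative g' s z) (at s)"
    and bound: "\<And>s z. \<bar>s - x\<bar> < d \<Longrightarrow> z \<in> space M \<Longrightarrow> \<bar>g' s z\<bar> \<le> h z"
    and h: "integrable M h"
    and meas: "g' x \<in> borel_measurable M"
  shows "((\<lambda>s. \<integral>z. g s z \<partial>M) has_real_derivative (\<integral>z. g' x z \<partial>M)) (at x)"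
  unfolding has_field_derivative_iff tendsto_at_iff_sequentially
proof (intro allI impI)
  fix X :: "nat \<Rightarrow> real" assume X: "\<forall>i. X i \<in> UNIV - {x}" and lim: "X \<longlonglongrightarrow> x"
  \<comment> \<open>The hypotheses hold only within distance \<open>d\<close> of \<open>x\<close>,
    so the first \<open>N\<close> terms of the sequence are dropped; the limit does not
    notice.\<close>
  obtain N where N: "\<And>n. n \<ge> N \<Longrightarrow> \<bar>X n - x\<bar> < d"
    using LIMSEQ_D[OF lim d] by auto
  define q where "q = (\<lambda>n z. (g (X (n + N)) z - g x z) / (X (n + N) - x))"
  have XN: "\<bar>X (n + N) - x\<bar> < d" "X (n + N) \<noteq> x" for n using N X by auto
  have "(\<lambda>n. \<integral>z. q n z \<partial>M) \<longlonglongrightarrow> (\<integral>z. g' x z \<partial>M)"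
  proof (rule integral_dominated_convergence[OF meas _ h])
    show "q n \<in> borel_measurable M" for n
    proof -
      have [measurable]: "g (X (n + N)) \<in> borel_measurable M" "g x \<in> borel_measurable M"
        using int[OF XN(1)] int[of x] d by auto
      show ?thesis unfolding q_def by measurable
    qed
    show "AE z in M. (\<lambda>n. q n z) \<longlonglongrightarrow> g' x z"
    proof (rule AE_I2)
      fix z assume z: "z \<in> space M"
      have "((\<lambda>s. (g s z - g x z) / (s - x)) \<longlongrightarrow> g' x z) (at x)"
        using deriv[of x z] d z by (simp add: has_field_derivative_iff)
      then have "(\<lambda>n. (g (X n) z - g x z) / (X n - x)) \<longlonglongrightarrow> g' x z"
        using X lim unfolding tendsto_at_iff_sequentially by (auto simp: o_def)
      then show "(\<lambda>n. q n z) \<longlonglongrightarrow> g' x z"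
        unfolding q_def by (rule LIMSEQ_ignore_initial_segment)
    qed
    show "AE z in M. norm (q n z) \<le> h z" for n
    proof (rule AE_I2)
      fix z assume z: "z \<in> space M"
      \<comment> \<open>By the mean value inequality the bound \<open>h\<close> on the derivative
        also bounds the difference quotients, which provides the integrable majorant.\<close>
      have "norm (g (X (n + N)) z - g x z) \<le> h z * norm (X (n + N) - x)"
      proof (rule field_differentiable_bound[of "{x - d<..<x + d}" _ "\<lambda>s. g' s z"])
        show "((\<lambda>s. g s z) has_field_derivative g' s z) (at s within {x - d<..<x + d})"
          if "s \<in> {x - d<..<x + d}" for s
          using that z by (intro has_field_derivative_at_within[OF deriv]) auto
        show "norm (g' s z) \<le> h z" if "s \<in> {x - d<..<x + d}" for s
          using that z bound[of s z] by auto
      qed (use XN[of n] d in auto)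
      then show "norm (q n z) \<le> h z"
        using XN(2)[of n] by (simp add: q_def divide_le_eq)
    qed
  qed
  moreover have "(\<integral>z. q n z \<partial>M) = ((\<integral>z. g (X (n + N)) z \<partial>M) - (\<integral>z. g x z \<partial>M)) / (X (n + N) - x)" for n
    unfolding q_def using int[OF XN(1)] int[of x] d by simp
  ultimately have "(\<lambda>n. ((\<integral>z. g (X (n + N)) z \<partial>M) - (\<integral>z. g x z \<partial>M)) / (X (n + N) - x)) \<longlonglongrightarrow> (\<integral>z. g' x z \<partial>M)"
    by simp
  then show "((\<lambda>y. ((\<integral>z. g y z \<partial>M) - (\<integral>z. g x z \<partial>M)) / (y - x)) \<circ> X) \<longlonglongrightarrow> (\<integral>z. g' x z \<partial>M)"
    unfolding o_def by (rule LIMSEQ_offset)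
qed

section \<open>The heat equation on the line\<close>

definition gauss :: "real \<Rightarrow> real \<Rightarrow> real" where
  "gauss t z = exp (- z\<^sup>2 / (4 * t)) / sqrt (4 * pi * t)"

definition gauss_x :: "real \<Rightarrow> real \<Rightarrow> real" where
  "gauss_x t z = - z / (2 * t) * gauss t z"

definition gauss_xx :: "real \<Rightarrow> real \<Rightarrow> real" where
  "gauss_xx t z = (z\<^sup>2 / (4 * t\<^sup>2) - 1 / (2 * t)) * gauss t z"

text \<open>The variance is \<open>2 * t\<close>; integrability and total mass one are inherited
  from the normal density.\<close>

lemma gauss_eq_normal_density: "t > 0 \<Longrightarrow> gauss t = normal_density 0 (sqrt (2 * t))"
  by (rule ext) (simp add: gauss_def normal_density_def field_simps)

lemma gauss_nonneg: "t > 0 \<Longrightarrow> gauss t z \<ge> 0"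
  by (simp add: gauss_def)

lemma gauss_uminus [simp]: "gauss t (- z) = gauss t z"
  by (simp add: gauss_def)

lemma integrable_gauss: "t > 0 \<Longrightarrow> integrable lborel (gauss t)"
  by (simp add: gauss_eq_normal_density)

lemma integral_gauss: "t > 0 \<Longrightarrow> (\<integral>z. gauss t z \<partial>lborel) = 1"
  by (simp add: gauss_eq_normal_density)

lemma gauss_deriv_x: "t > 0 \<Longrightarrow> (gauss t has_real_derivative gauss_x t z) (at z)"
  unfolding gauss_def[abs_def] gauss_x_def by (auto intro!: derivative_eq_intros simp: field_simps)

lemma gauss_deriv_xx:
  assumes "t > 0"
  shows "(gauss_x t has_real_derivative gauss_xx t z) (at z)"
proof -
  have "((\<lambda>z. - z / (2 * t) * gauss t z) has_real_derivative
      - 1 / (2 * t) * gauss t z + gauss_x t z * (- z / (2 * t))) (at z)"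
    using assms by (intro DERIV_mult gauss_deriv_x) (auto intro!: derivative_eq_intros)
  also have "- 1 / (2 * t) * gauss t z + gauss_x t z * (- z / (2 * t)) = gauss_xx t z"
    using assms by (simp add: gauss_x_def gauss_xx_def field_simps power2_eq_square)
  finally show ?thesis unfolding gauss_x_def .
qed

text \<open>The time derivative is the same function \<open>gauss_xx\<close> that arises as second
  space derivative: this is the heat equation for the Gaussian.\<close>

lemma gauss_deriv_t:
  assumes t: "t > 0"
  shows "((\<lambda>s. gauss s z) has_real_derivative gauss_xx t z) (at t)"
proof -
  define r where "r = sqrt (4 * pi * t)"
  have r: "r > 0" and r2: "r\<^sup>2 = 4 * pi * t" using t by (simp_all add: r_def)
  have 1: "((\<lambda>s. exp (- z\<^sup>2 / (4 * s))) has_real_derivative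
      exp (- z\<^sup>2 / (4 * t)) * (z\<^sup>2 / (4 * t\<^sup>2))) (at t)"
    using t by (auto intro!: derivative_eq_intros simp: power2_eq_square)
  have "((\<lambda>s. 4 * pi * s) has_real_derivative 4 * pi) (at t)"
    by (auto intro!: derivative_eq_intros)
  then have "((\<lambda>s. sqrt (4 * pi * s)) has_real_derivative inverse r / 2 * (4 * pi)) (at t)"
    unfolding r_def using t
    by (intro DERIV_chain2[where f = sqrt and g = "\<lambda>s. 4 * pi * s"] DERIV_real_sqrt) auto
  also have "inverse r / 2 * (4 * pi) = r / (2 * t)"
    using r t r2 by (simp add: field_simps power2_eq_square)
  finally have 2: "((\<lambda>s. sqrt (4 * pi * s)) has_real_derivative r / (2 * t)) (at t)" .
  have "((\<lambda>s. gauss s z) has_real_derivative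
      (exp (- z\<^sup>2 / (4 * t)) * (z\<^sup>2 / (4 * t\<^sup>2)) * r - exp (- z\<^sup>2 / (4 * t)) * (r / (2 * t))) / (r * r)) (at t)"
    using DERIV_divide[OF 1 2] r unfolding gauss_def r_def[symmetric] by blast
  also have "(exp (- z\<^sup>2 / (4 * t)) * (z\<^sup>2 / (4 * t\<^sup>2)) * r - exp (- z\<^sup>2 / (4 * t)) * (r / (2 * t))) / (r * r)
      = gauss_xx t z"
    unfolding gauss_xx_def gauss_def r_def[symmetric] using r t
    by (simp add: field_simps)
  finally show ?thesis .
qed

lemma borel_measurable_gauss [measurable]:
  "gauss t \<in> borel_measurable borel" "gauss_x t \<in> borel_measurable borel" "gauss_xx t \<in> borel_measurable borel"
  unfolding gauss_def[abs_def] gauss_x_def[abs_def] gauss_xx_def[abs_def] by measurable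

text \<open>A single integrable majorant in \<open>z\<close> serves the Gaussian and both
  derivatives, uniformly for \<open>(t, x)\<close> near \<open>(t\<^sub>0, x\<^sub>0)\<close>. Half
  of the Gaussian exponent absorbs the polynomial prefactors; the other half is dominated by a wider
  Gaussian with fixed centre \<open>x\<^sub>0\<close>.\<close>

lemma gauss_dominated:
  fixes t\<^sub>0 x\<^sub>0 :: real
  assumes t0: "t\<^sub>0 > 0"
  obtains h where "integrable lborel h"
    and "\<And>t x z. \<bar>t - t\<^sub>0\<bar> < t\<^sub>0 / 2 \<Longrightarrow> \<bar>x - x\<^sub>0\<bar> < 1 \<Longrightarrow> \<bar>gauss t (x - z)\<bar> \<le> h z"
    and "\<And>t x z. \<bar>t - t\<^sub>0\<bar> < t\<^sub>0 / 2 \<Longrightarrow> \<bar>x - x\<^sub>0\<bar> < 1 \<Longrightarrow> \<bar>gauss_x t (x - z)\<bar> \<le> h z"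
    and "\<And>t x z. \<bar>t - t\<^sub>0\<bar> < t\<^sub>0 / 2 \<Longrightarrow> \<bar>x - x\<^sub>0\<bar> < 1 \<Longrightarrow> \<bar>gauss_xx t (x - z)\<bar> \<le> h z"
proof -
  \<comment> \<open>\<open>c\<close> is the normalizing factor at the earliest time
    \<open>t\<^sub>0 / 2\<close>. \<open>C\<close> exceeds the factors \<open>1\<close>,
    \<open>4 + 1 / t\<^sub>0\<close> and \<open>5 / t\<^sub>0\<close> met in the three bounds. The
    time \<open>6 * t\<^sub>0\<close> in \<open>h\<close> results from
    \<open>t < 3 * t\<^sub>0 / 2\<close> and
    \<open>(x\<^sub>0 - z)\<^sup>2 - 2 \<le> 2 * w\<^sup>2\<close>; the \<open>2\<close> subtracted
    there becomes the factor \<open>exp (1 / (12 * t\<^sub>0))\<close>.\<close>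
  define c where "c = 1 / sqrt (2 * pi * t\<^sub>0)"
  define C where "C = 4 + 5 / t\<^sub>0"
  define h where "h = (\<lambda>z. C * c * exp (1 / (12 * t\<^sub>0)) * sqrt (4 * pi * (6 * t\<^sub>0)) * gauss (6 * t\<^sub>0) (x\<^sub>0 - z))"
  have c: "c > 0" and C: "C \<ge> 1" using t0 by (auto simp: c_def C_def)
  have "integrable lborel h"
    unfolding h_def using lborel_integrable_real_affine[OF integrable_gauss[of "6 * t\<^sub>0"], of "-1" x\<^sub>0] t0
    by (intro integrable_mult_right) simp
  moreover have "\<bar>gauss t (x - z)\<bar> \<le> h z \<and> \<bar>gauss_x t (x - z)\<bar> \<le> h z \<and> \<bar>gauss_xx t (x - z)\<bar> \<le> h z"
    if tt: "\<bar>t - t\<^sub>0\<bar> < t\<^sub>0 / 2" and xx: "\<bar>x - x\<^sub>0\<bar> < 1" for t x z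
  proof -
    define w where "w = x - z"
    \<comment> \<open>The square root of the exponential in \<open>gauss t w\<close>, so that one
      factor \<open>e\<close> can be spent on \<open>w\<^sup>2\<close> and one kept for
      decay.\<close>
    define e where "e = exp (- (w\<^sup>2 / (8 * t)))"
    have t: "t > t\<^sub>0 / 2" "t < 3 * t\<^sub>0 / 2" using tt by (auto simp: abs_if split: if_splits)
    then have tpos: "t > 0" using t0 by simp
    have e: "e > 0" by (simp add: e_def)
    have e1: "e \<le> 1" using tpos by (simp add: e_def)
    have exp_bd: "y * exp (- y) \<le> 1" for y :: real
    proof -
      have "y \<le> exp y" using exp_ge_add_one_self[of y] by linarith
      then show ?thesis by (simp add: exp_minus field_simps)
    qed
    have we: "w\<^sup>2 * e \<le> 8 * t" using exp_bd[of "w\<^sup>2 / (8 * t)"] tpos by (simp add: e_def field_simps)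
    have ge: "gauss t w = e * e / sqrt (4 * pi * t)"
      by (simp add: gauss_def e_def flip: exp_add)
    have sq: "1 / sqrt (4 * pi * t) \<le> c" unfolding c_def
      using t0 t by (intro divide_left_mono real_sqrt_le_mono) auto
    have g1: "gauss t w \<le> c * e"
    proof -
      have "gauss t w = (1 / sqrt (4 * pi * t)) * (e * e)" by (simp add: ge)
      also have "\<dots> \<le> c * (e * 1)" using sq e e1 c tpos by (intro mult_mono) auto
      finally show ?thesis by simp
    qed
    have g2: "w\<^sup>2 * gauss t w \<le> 8 * t * (c * e)"
    proof -
      have "w\<^sup>2 * gauss t w = (w\<^sup>2 * e) * ((1 / sqrt (4 * pi * t)) * e)" by (simp add: ge)
      also have "\<dots> \<le> (8 * t) * (c * e)"
        by (rule mult_mono[OF we mult_right_mono[OF sq]]) (use e c tpos in auto)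
      finally show ?thesis .
    qed
    have ce: "c * e > 0" using c e by simp
    have gn: "gauss t w \<ge> 0" using gauss_nonneg tpos by simp
    have b0: "\<bar>gauss t w\<bar> \<le> C * (c * e)"
      using g1 gn C ce mult_right_mono[of 1 C "c * e"] by simp
    have it: "1 / (2 * t) \<le> 1 / t\<^sub>0" using t t0 by (simp add: field_simps)
    have b1: "\<bar>gauss_x t w\<bar> \<le> C * (c * e)"
    proof -
      \<comment> \<open>Reduces the odd moment to the two bounds \<open>g1\<close> and
        \<open>g2\<close> already available.\<close>
      have "\<bar>w\<bar> \<le> 1 + w\<^sup>2" using zero_le_power2[of "\<bar>w\<bar> - 1"] by (simp add: power2_diff)
      then have "\<bar>w\<bar> * gauss t w \<le> (1 + w\<^sup>2) * gauss t w" using gn by (rule mult_right_mono)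
      also have "\<dots> \<le> (1 + 8 * t) * (c * e)" using g1 g2 by (simp add: algebra_simps)
      finally have "\<bar>w\<bar> * gauss t w * (1 / (2 * t)) \<le> (1 + 8 * t) * (c * e) * (1 / (2 * t))"
        using tpos by (intro mult_right_mono) auto
      also have "\<dots> = (1 / (2 * t) + 4) * (c * e)" using tpos by (simp add: field_simps)
      also have "\<dots> \<le> C * (c * e)"
        using it t0 ce by (intro mult_right_mono) (auto simp: C_def divide_right_mono intro: order_trans)
      finally show ?thesis using tpos gn by (simp add: gauss_x_def abs_mult)
    qed
    have b2: "\<bar>gauss_xx t w\<bar> \<le> C * (c * e)"
    proof -
      have "\<bar>gauss_xx t w\<bar> \<le> (w\<^sup>2 / (4 * t\<^sup>2) + 1 / (2 * t)) * gauss t w"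
        using tpos gn by (simp add: gauss_xx_def abs_mult) (intro mult_right_mono order_trans[OF abs_triangle_ineq4]; simp)
      also have "\<dots> = (w\<^sup>2 * gauss t w) * (1 / (4 * t\<^sup>2)) + gauss t w * (1 / (2 * t))"
        by (simp add: algebra_simps)
      also have "\<dots> \<le> 8 * t * (c * e) * (1 / (4 * t\<^sup>2)) + c * e * (1 / (2 * t))"
        using g1 g2 tpos by (intro add_mono mult_right_mono) auto
      also have "\<dots> = 5 * (1 / (2 * t)) * (c * e)" using tpos by (simp add: field_simps power2_eq_square)
      also have "\<dots> \<le> C * (c * e)"
        using it ce by (intro mult_right_mono) (auto simp: C_def)
      finally show ?thesis .
    qed
    have "C * (c * e) \<le> h z"
    proof -
      have "(x\<^sub>0 - z)\<^sup>2 = (w - (x - x\<^sub>0))\<^sup>2" by (simp add: w_def)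
      also have "\<dots> \<le> 2 * w\<^sup>2 + 2 * (x - x\<^sub>0)\<^sup>2"
        using zero_le_power2[of "w + (x - x\<^sub>0)"] by (simp add: power2_eq_square algebra_simps)
      also have "(x - x\<^sub>0)\<^sup>2 \<le> 1" using xx by (simp add: abs_square_le_1)
      finally have "(x\<^sub>0 - z)\<^sup>2 - 2 \<le> 2 * w\<^sup>2" by simp
      then have "((x\<^sub>0 - z)\<^sup>2 - 2) / (24 * t\<^sub>0) \<le> 2 * w\<^sup>2 / (24 * t\<^sub>0)"
        using t0 by (intro divide_right_mono) auto
      also have "\<dots> = w\<^sup>2 / (12 * t\<^sub>0)" by simp
      also have "\<dots> \<le> w\<^sup>2 / (8 * t)" using t t0 by (intro divide_left_mono) auto
      finally have "e \<le> exp (- (((x\<^sub>0 - z)\<^sup>2 - 2) / (24 * t\<^sub>0)))" by (simp add: e_def)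
      also have "\<dots> = exp (1 / (12 * t\<^sub>0)) * exp (- (x\<^sub>0 - z)\<^sup>2 / (4 * (6 * t\<^sub>0)))"
        using t0 by (simp add: field_simps flip: exp_add)
      finally have eb: "e \<le> exp (1 / (12 * t\<^sub>0)) * exp (- (x\<^sub>0 - z)\<^sup>2 / (4 * (6 * t\<^sub>0)))" .
      have *: "e \<le> exp (1 / (12 * t\<^sub>0)) * (sqrt (4 * pi * (6 * t\<^sub>0)) * gauss (6 * t\<^sub>0) (x\<^sub>0 - z))"
      proof -
        have "sqrt (4 * pi * (6 * t\<^sub>0)) \<noteq> 0" using t0 by simp
        moreover have "s * (E / s) = E" if "s \<noteq> 0" for s E :: real using that by simp
        ultimately have "sqrt (4 * pi * (6 * t\<^sub>0)) * gauss (6 * t\<^sub>0) (x\<^sub>0 - z) = exp (- (x\<^sub>0 - z)\<^sup>2 / (4 * (6 * t\<^sub>0)))"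
          unfolding gauss_def by blast
        then show ?thesis using eb by (simp only:)
      qed
      have "C * (c * e) \<le> C * (c * (exp (1 / (12 * t\<^sub>0)) * (sqrt (4 * pi * (6 * t\<^sub>0)) * gauss (6 * t\<^sub>0) (x\<^sub>0 - z))))"
        using * C c by (intro mult_left_mono) auto
      then show ?thesis by (simp add: h_def mult.assoc)
    qed
    with b0 b1 b2 show ?thesis unfolding w_def by linarith
  qed
  ultimately show thesis using that by blast
qed

section \<open>Convolution of the Gaussian with a bounded continuous function\<close>

context
  fixes F :: "real \<Rightarrow> real" and B :: real
  assumes F: "continuous_on UNIV F" and B: "\<And>z. \<bar>F z\<bar> \<le> B"
begin

lemma F_measurable [measurable]: "F \<in> borel_measurable borel"
  using F by (rule borel_measurable_continuous_onI)

lemma integrable_gauss_convolution: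
  assumes "integrable lborel h" "\<And>z. \<bar>k z\<bar> \<le> h z" "k \<in> borel_measurable borel"
  shows "integrable lborel (\<lambda>z. k z * F z)"
proof (rule Bochner_Integration.integrable_bound)
  show "integrable lborel (\<lambda>z. h z * B)" using assms by simp
  show "AE z in lborel. norm (k z * F z) \<le> norm (h z * B)"
  proof (rule AE_I2)
    fix z
    have "norm (k z * F z) \<le> h z * B"
      unfolding real_norm_def abs_mult using assms(2)[of z] B[of z] by (intro mult_mono) auto
    then show "norm (k z * F z) \<le> norm (h z * B)" by simp
  qed
  show "(\<lambda>z. k z * F z) \<in> borel_measurable lborel" using assms(3) by measurable
qed

text \<open>The first and third derivatives are the same integral, so the convolution solves the
  heat equation. Boundedness of \<open>F\<close> turns the majorant of the Gaussian derivatives into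
  one of the integrands.\<close>

lemma heat_line_derivatives:
  assumes t: "t > 0"
  shows "((\<lambda>s. \<integral>z. gauss s (x - z) * F z \<partial>lborel) has_real_derivative
            (\<integral>z. gauss_xx t (x - z) * F z \<partial>lborel)) (at t)"
    and "((\<lambda>y. \<integral>z. gauss t (y - z) * F z \<partial>lborel) has_real_derivative
            (\<integral>z. gauss_x t (x - z) * F z \<partial>lborel)) (at x)"
    and "((\<lambda>y. \<integral>z. gauss_x t (y - z) * F z \<partial>lborel) has_real_derivative
            (\<integral>z. gauss_xx t (x - z) * F z \<partial>lborel)) (at x)"
proof -
  obtain h where h: "integrable lborel h"
    and h0: "\<And>s y z. \<bar>s - t\<bar> < t / 2 \<Longrightarrow> \<bar>y - x\<bar> < 1 \<Longrightarrow> \<bar>gauss s (y - z)\<bar> \<le> h z"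
    and h1: "\<And>s y z. \<bar>s - t\<bar> < t / 2 \<Longrightarrow> \<bar>y - x\<bar> < 1 \<Longrightarrow> \<bar>gauss_x s (y - z)\<bar> \<le> h z"
    and h2: "\<And>s y z. \<bar>s - t\<bar> < t / 2 \<Longrightarrow> \<bar>y - x\<bar> < 1 \<Longrightarrow> \<bar>gauss_xx s (y - z)\<bar> \<le> h z"
    using gauss_dominated[OF t, of x] by metis
  have hB: "integrable lborel (\<lambda>z. h z * B)" using h by simp
  have bd: "\<bar>k * F z\<bar> \<le> h z * B" if "\<bar>k\<bar> \<le> h z" for k z
    unfolding abs_mult using that B[of z] by (intro mult_mono) auto
  have tt: "\<bar>t - t\<bar> < t / 2" "\<bar>x - x\<bar> < 1" using t by auto
  show "((\<lambda>s. \<integral>z. gauss s (x - z) * F z \<partial>lborel) has_real_derivative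
            (\<integral>z. gauss_xx t (x - z) * F z \<partial>lborel)) (at t)"
  proof (rule leibniz_rule_dominated[where d = "t / 2" and h = "\<lambda>z. h z * B"])
    show "integrable lborel (\<lambda>z. gauss s (x - z) * F z)" if "\<bar>s - t\<bar> < t / 2" for s
      by (rule integrable_gauss_convolution[OF h h0[OF that tt(2)]]) measurable
    show "((\<lambda>s. gauss s (x - z) * F z) has_real_derivative gauss_xx s (x - z) * F z) (at s)"
      if "\<bar>s - t\<bar> < t / 2" for s z
      using that t by (intro DERIV_cmult_right gauss_deriv_t) (auto simp: abs_if split: if_splits)
    show "\<bar>gauss_xx s (x - z) * F z\<bar> \<le> h z * B" if "\<bar>s - t\<bar> < t / 2" for s z
      by (rule bd[OF h2[OF that tt(2)]])
  qed (use t hB in auto)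
  have shift: "((\<lambda>y. k (y - z)) has_real_derivative D) (at y)"
    if "(k has_real_derivative D) (at (y - z))" for k D and y z :: real
    using that DERIV_shift[of k D y "- z"] by simp
  show "((\<lambda>y. \<integral>z. gauss t (y - z) * F z \<partial>lborel) has_real_derivative
            (\<integral>z. gauss_x t (x - z) * F z \<partial>lborel)) (at x)"
  proof (rule leibniz_rule_dominated[where d = 1 and h = "\<lambda>z. h z * B"])
    show "integrable lborel (\<lambda>z. gauss t (y - z) * F z)" if "\<bar>y - x\<bar> < 1" for y
      by (rule integrable_gauss_convolution[OF h h0[OF tt(1) that]]) measurable
    show "((\<lambda>y. gauss t (y - z) * F z) has_real_derivative gauss_x t (y - z) * F z) (at y)" for y z
      using t by (intro DERIV_cmult_right shift gauss_deriv_x)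
    show "\<bar>gauss_x t (y - z) * F z\<bar> \<le> h z * B" if "\<bar>y - x\<bar> < 1" for y z
      by (rule bd[OF h1[OF tt(1) that]])
  qed (use hB in auto)
  show "((\<lambda>y. \<integral>z. gauss_x t (y - z) * F z \<partial>lborel) has_real_derivative
            (\<integral>z. gauss_xx t (x - z) * F z \<partial>lborel)) (at x)"
  proof (rule leibniz_rule_dominated[where d = 1 and h = "\<lambda>z. h z * B"])
    show "integrable lborel (\<lambda>z. gauss_x t (y - z) * F z)" if "\<bar>y - x\<bar> < 1" for y
      by (rule integrable_gauss_convolution[OF h h1[OF tt(1) that]]) measurable
    show "((\<lambda>y. gauss_x t (y - z) * F z) has_real_derivative gauss_xx t (y - z) * F z) (at y)" for y z
      using t by (intro DERIV_cmult_right shift gauss_deriv_xx)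
    show "\<bar>gauss_xx t (y - z) * F z\<bar> \<le> h z * B" if "\<bar>y - x\<bar> < 1" for y z
      by (rule bd[OF h2[OF tt(1) that]])
  qed (use hB in auto)
qed

text \<open>The substitution \<open>z = x + sqrt (2 * t) * w\<close> moves the time dependence from
  the weight into the argument of \<open>F\<close>. The right-hand side stays meaningful at
  \<open>t = 0\<close>, where the left-hand side degenerates.\<close>

lemma heat_line_rescaled:
  assumes t: "t > 0"
  shows "(\<integral>z. gauss t (x - z) * F z \<partial>lborel) = (\<integral>w. std_normal_density w * F (x + sqrt (2 * t) * w) \<partial>lborel)"
proof -
  define c where "c = sqrt (2 * t)"
  have c: "c > 0" and c2: "c\<^sup>2 = 2 * t" using t by (auto simp: c_def)
  have "(\<integral>z. gauss t (x - z) * F z \<partial>lborel) = c * (\<integral>w. gauss t (x - (x + c * w)) * F (x + c * w) \<partial>lborel)"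
    using lborel_integral_real_affine[of c "\<lambda>z. gauss t (x - z) * F z" x] c by simp
  also have "\<dots> = (\<integral>w. c * (gauss t (x - (x + c * w)) * F (x + c * w)) \<partial>lborel)" by simp
  also have "(\<lambda>w. c * (gauss t (x - (x + c * w)) * F (x + c * w))) = (\<lambda>w. std_normal_density w * F (x + c * w))"
  proof
    fix w
    have "gauss t (c * w) = exp (- (c * w)\<^sup>2 / (2 * c\<^sup>2)) / (sqrt (2 * pi) * c)"
      using c by (simp add: gauss_eq_normal_density[OF t, folded c_def] normal_density_def real_sqrt_mult)
    then have "c * gauss t (c * w) = std_normal_density w"
      using c by (simp add: std_normal_density_def power_mult_distrib)
    then show "c * (gauss t (x - (x + c * w)) * F (x + c * w)) = std_normal_density w * F (x + c * w)"
      by (simp add: mult.assoc[symmetric])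
  qed
  finally show ?thesis by (simp add: c_def)
qed

text \<open>The weight no longer depends on \<open>(t, x)\<close>, so one integrable majorant
  suffices for dominated convergence along any sequence, including those that reach
  \<open>t = 0\<close>.\<close>

lemma heat_line_continuous:
  "continuous_on ({0..} \<times> UNIV) (\<lambda>(t, x). \<integral>w. std_normal_density w * F (x + sqrt (2 * t) * w) \<partial>lborel)"
  unfolding continuous_on_sequentially
proof (intro allI ballI impI)
  fix X :: "nat \<Rightarrow> real \<times> real" and p assume "(\<forall>n. X n \<in> {0..} \<times> UNIV) \<and> X \<longlonglongrightarrow> p"
  then have X: "X \<longlonglongrightarrow> p" by simp
  have "(\<lambda>n. \<integral>w. std_normal_density w * F (snd (X n) + sqrt (2 * fst (X n)) * w) \<partial>lborel)
    \<longlonglongrightarrow> (\<integral>w. std_normal_density w * F (snd p + sqrt (2 * fst p) * w) \<partial>lborel)"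
  proof (rule integral_dominated_convergence[where w = "\<lambda>w. std_normal_density w * B"])
    show "integrable lborel (\<lambda>w. std_normal_density w * B)" by simp
    show "AE w in lborel. (\<lambda>n. std_normal_density w * F (snd (X n) + sqrt (2 * fst (X n)) * w))
      \<longlonglongrightarrow> std_normal_density w * F (snd p + sqrt (2 * fst p) * w)"
    proof (rule AE_I2)
      fix w
      have "(\<lambda>n. snd (X n) + sqrt (2 * fst (X n)) * w) \<longlonglongrightarrow> snd p + sqrt (2 * fst p) * w"
        using X by (intro tendsto_intros)
      then have "(\<lambda>n. F (snd (X n) + sqrt (2 * fst (X n)) * w)) \<longlonglongrightarrow> F (snd p + sqrt (2 * fst p) * w)"
        by (rule continuous_on_tendsto_compose[OF F]) auto
      then show "(\<lambda>n. std_normal_density w * F (snd (X n) + sqrt (2 * fst (X n)) * w))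
      \<longlonglongrightarrow> std_normal_density w * F (snd p + sqrt (2 * fst p) * w)"
        by (intro tendsto_intros)
    qed
    show "AE w in lborel. norm (std_normal_density w * F (snd (X n) + sqrt (2 * fst (X n)) * w))
      \<le> std_normal_density w * B" for n
      using B by (intro AE_I2) (auto simp: abs_mult intro!: mult_left_mono)
  qed measurable
  then show "((\<lambda>(t, x). \<integral>w. std_normal_density w * F (x + sqrt (2 * t) * w) \<partial>lborel) \<circ> X)
    \<longlonglongrightarrow> (\<lambda>(t, x). \<integral>w. std_normal_density w * F (x + sqrt (2 * t) * w) \<partial>lborel) p"
    by (simp add: o_def case_prod_unfold)
qed

end

lemma integral_tendsto_whole_line:
  fixes H :: "real \<Rightarrow> real"
  assumes H: "continuous_on UNIV H" and int: "integrable lborel H"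
    and a: "filterlim a at_bot sequentially" and b: "filterlim b at_top sequentially"
  shows "(\<lambda>n::nat. integral {a n..b n} H) \<longlonglongrightarrow> (\<integral>z. H z \<partial>lborel)"
proof -
  have [measurable]: "H \<in> borel_measurable borel" using H by (rule borel_measurable_continuous_onI)
  have "(\<lambda>n. \<integral>z. indicator {a n..b n} z * H z \<partial>lborel) \<longlonglongrightarrow> (\<integral>z. H z \<partial>lborel)"
  proof (rule integral_dominated_convergence[where w = "\<lambda>z. \<bar>H z\<bar>"])
    show "AE z in lborel. (\<lambda>n. indicator {a n..b n} z * H z) \<longlonglongrightarrow> H z"
    proof (rule AE_I2)
      fix z
      have "eventually (\<lambda>n. a n \<le> z) sequentially" "eventually (\<lambda>n. z \<le> b n) sequentially"
        using a b by (auto simp: filterlim_at_bot filterlim_at_top)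
      then have "eventually (\<lambda>n. indicator {a n..b n} z * H z = H z) sequentially"
        by eventually_elim auto
      then show "(\<lambda>n. indicator {a n..b n} z * H z) \<longlonglongrightarrow> H z" by (rule tendsto_eventually)
    qed
  qed (use int in \<open>auto simp: indicator_def\<close>)
  moreover have "(\<integral>z. indicator {a n..b n} z * H z \<partial>lborel) = integral {a n..b n} H" for n
  proof -
    have "set_integrable lborel {a n..b n} H"
      unfolding set_integrable_def by (rule borel_integrable_compact) (auto intro: continuous_on_subset[OF H])
    from set_borel_integral_eq_integral(2)[OF this] show ?thesis by (simp add: set_lebesgue_integral_def)
  qed
  ultimately show ?thesis by simp
qed

section \<open>The periodized Gaussian\<close>

text \<open>The translates by \<open>2 * L * n\<close> and \<open>- 2 * L * n\<close> are paired so that partial sums are even and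
  correspond to integrals over symmetric intervals.\<close>

definition theta_partial :: "real \<Rightarrow> nat \<Rightarrow> real \<Rightarrow> real \<Rightarrow> real" where
  "theta_partial L N t z =
     gauss t z + (\<Sum>n<N. gauss t (z + 2 * L * real (Suc n)) + gauss t (z - 2 * L * real (Suc n)))"

definition theta :: "real \<Rightarrow> real \<Rightarrow> real \<Rightarrow> real" where
  "theta L t z =
     gauss t z + (\<Sum>n. gauss t (z + 2 * L * real (Suc n)) + gauss t (z - 2 * L * real (Suc n)))"

text \<open>The inequality \<open>c\<^sup>2 / 2 - z\<^sup>2 \<le> (z + c)\<^sup>2\<close> separates
  the translation from the point. The time is then replaced by \<open>a\<close> where this enlarges
  the bound and by \<open>b\<close> where it slows the decay, which makes the estimate
  uniform.\<close>

lemma gauss_translate_bound: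
  assumes a: "0 < a" "a \<le> t" "t \<le> b" and z: "\<bar>z\<bar> \<le> R" and c: "\<bar>c\<bar> = 2 * L * real (Suc n)"
  shows "gauss t (z + c) \<le> exp (R\<^sup>2 / (4 * a)) / sqrt (4 * pi * a) * exp (- (L\<^sup>2 / (2 * b))) ^ Suc n"
proof -
  have t: "t > 0" using a by simp
  have z2: "z\<^sup>2 \<le> R\<^sup>2" using power_mono[OF z abs_ge_zero, of 2] by simp
  define m where "m = real (Suc n)"
  have m: "1 \<le> m" by (simp add: m_def)
  have "c\<^sup>2 = (2 * L * m)\<^sup>2" unfolding m_def c[symmetric] by simp
  then have "c\<^sup>2 = 4 * (L\<^sup>2 * m\<^sup>2)" by (simp add: power_mult_distrib)
  \<comment> \<open>Giving up quadratic decay in the exponent yields a geometric sequence, which is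
    summable in closed form.\<close>
  moreover have "L\<^sup>2 * m \<le> L\<^sup>2 * m\<^sup>2" using m by (intro mult_left_mono self_le_power) auto
  moreover have "c\<^sup>2 / 2 - z\<^sup>2 \<le> (z + c)\<^sup>2"
    using zero_le_power2[of "2 * z + c"] by (simp add: power2_sum power_mult_distrib)
  ultimately have "2 * (L\<^sup>2 * m) - R\<^sup>2 \<le> (z + c)\<^sup>2" using z2 by linarith
  then have "2 * L\<^sup>2 * real (Suc n) - R\<^sup>2 \<le> (z + c)\<^sup>2" by (simp only: m_def mult.assoc)
  then have "- (z + c)\<^sup>2 / (4 * t) \<le> (R\<^sup>2 - 2 * L\<^sup>2 * real (Suc n)) / (4 * t)"
    using t by (intro divide_right_mono) auto
  also have "\<dots> = R\<^sup>2 / (4 * t) - L\<^sup>2 * real (Suc n) / (2 * t)"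
    by (simp add: diff_divide_distrib)
  also have "\<dots> \<le> R\<^sup>2 / (4 * a) - L\<^sup>2 * real (Suc n) / (2 * b)"
    using a t by (intro diff_mono divide_left_mono) auto
  finally have "exp (- (z + c)\<^sup>2 / (4 * t)) \<le> exp (R\<^sup>2 / (4 * a) - L\<^sup>2 * real (Suc n) / (2 * b))"
    by simp
  also have "\<dots> = exp (R\<^sup>2 / (4 * a)) * exp (- (L\<^sup>2 / (2 * b))) ^ Suc n"
    unfolding exp_of_nat_mult[symmetric] exp_add[symmetric] by (simp only: minus_divide_left) (simp add: algebra_simps)
  finally have "gauss t (z + c) \<le> (exp (R\<^sup>2 / (4 * a)) * exp (- (L\<^sup>2 / (2 * b))) ^ Suc n) / sqrt (4 * pi * t)"
    unfolding gauss_def using t by (intro divide_right_mono) auto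
  also have "\<dots> \<le> (exp (R\<^sup>2 / (4 * a)) * exp (- (L\<^sup>2 / (2 * b))) ^ Suc n) / sqrt (4 * pi * a)"
    using a t by (intro divide_left_mono) auto
  finally show ?thesis by simp
qed

text \<open>Uniformity in \<open>t\<close> together with \<open>z\<close> is what yields joint
  continuity of theta, as required of a heat kernel.\<close>

lemma theta_uniform_limit:
  assumes L: "L > 0" and ab: "0 < a" "a \<le> b"
  shows "uniform_limit ({a..b} \<times> {-R..R}) (\<lambda>N (t, z). theta_partial L N t z) (\<lambda>(t, z). theta L t z) sequentially"
proof -
  define C where "C = exp (R\<^sup>2 / (4 * a)) / sqrt (4 * pi * a)"
  define q where "q = exp (- (L\<^sup>2 / (2 * b)))"
  have q: "0 < q" "q < 1" using L ab by (auto simp: q_def)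
  have "summable (\<lambda>n. q ^ Suc n)" using q by (subst summable_Suc_iff) (simp add: summable_geometric)
  then have sum: "summable (\<lambda>n. 2 * C * q ^ Suc n)" by (rule summable_mult)
  have "uniform_limit ({a..b} \<times> {-R..R})
      (\<lambda>N p. \<Sum>n<N. gauss (fst p) (snd p + 2 * L * real (Suc n)) + gauss (fst p) (snd p - 2 * L * real (Suc n)))
      (\<lambda>p. \<Sum>n. gauss (fst p) (snd p + 2 * L * real (Suc n)) + gauss (fst p) (snd p - 2 * L * real (Suc n))) sequentially"
  proof (rule Weierstrass_m_test[OF _ sum])
    fix n and p :: "real \<times> real" assume p: "p \<in> {a..b} \<times> {-R..R}"
    define t z where "t = fst p" and "z = snd p"
    have t: "a \<le> t" "t \<le> b" and z: "\<bar>z\<bar> \<le> R" using p by (auto simp: t_def z_def)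
    have "gauss t (z + c) \<le> C * q ^ Suc n" if "\<bar>c\<bar> = 2 * L * real (Suc n)" for c
      unfolding C_def q_def by (rule gauss_translate_bound[OF ab(1) t z that])
    from this[of "2 * L * real (Suc n)"] this[of "- (2 * L * real (Suc n))"]
    have "gauss t (z + 2 * L * real (Suc n)) + gauss t (z - 2 * L * real (Suc n)) \<le> 2 * C * q ^ Suc n"
      using L by simp
    moreover have "gauss t w \<ge> 0" for w using gauss_nonneg t ab by simp
    ultimately show "norm (gauss (fst p) (snd p + 2 * L * real (Suc n)) + gauss (fst p) (snd p - 2 * L * real (Suc n)))
        \<le> 2 * C * q ^ Suc n"
      by (simp only: real_norm_def t_def[symmetric] z_def[symmetric] abs_of_nonneg add_nonneg_nonneg)
  qed
  from uniform_limit_add[OF uniform_limit_const this, of "\<lambda>p. gauss (fst p) (snd p)"]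
  show ?thesis unfolding theta_partial_def theta_def case_prod_unfold .
qed

lemma theta_uniform_limit_space:
  assumes "L > 0" "t > 0"
  shows "uniform_limit {-R..R} (\<lambda>N. theta_partial L N t) (theta L t) sequentially"
  using uniform_limit_compose'[OF theta_uniform_limit[of L t t R], of "\<lambda>z. (t, z)" "{-R..R}"] assms
  by auto

lemma theta_partial_tendsto:
  assumes "L > 0" "t > 0"
  shows "(\<lambda>N. theta_partial L N t z) \<longlonglongrightarrow> theta L t z"
  by (rule tendsto_uniform_limitI[OF theta_uniform_limit_space[OF assms, of "\<bar>z\<bar>"]]) auto

lemma continuous_on_theta_partial:
  "continuous_on ({0<..} \<times> UNIV) (\<lambda>(t, z). theta_partial L N t z)"
  unfolding theta_partial_def gauss_def case_prod_unfold by (intro continuous_intros) auto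

lemma continuous_on_theta:
  assumes L: "L > 0"
  shows "continuous_on ({0<..} \<times> UNIV) (\<lambda>(t, z). theta L t z)"
proof (rule continuous_at_imp_continuous_on, safe)
  fix t z :: real assume t: "t > 0"
  have "continuous_on ({t/2..2*t} \<times> {-(\<bar>z\<bar> + 1)..\<bar>z\<bar> + 1}) (\<lambda>(t, z). theta L t z)"
  proof (rule uniform_limit_theorem[OF always_eventually theta_uniform_limit[OF L]])
    show "\<forall>N. continuous_on ({t/2..2*t} \<times> {-(\<bar>z\<bar> + 1)..\<bar>z\<bar> + 1}) (\<lambda>(t, z). theta_partial L N t z)"
      using t by (intro allI continuous_on_subset[OF continuous_on_theta_partial]) auto
  qed (use t in auto)
  then have "continuous_on ({t/2<..<2*t} \<times> {-(\<bar>z\<bar> + 1)<..<\<bar>z\<bar> + 1}) (\<lambda>(t, z). theta L t z)"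
    by (rule continuous_on_subset) auto
  moreover have "open ({t/2<..<2*t} \<times> {-(\<bar>z\<bar> + 1)<..<\<bar>z\<bar> + 1})" by (intro open_Times) auto
  moreover have "(t, z) \<in> {t/2<..<2*t} \<times> {-(\<bar>z\<bar> + 1)<..<\<bar>z\<bar> + 1}" using t by auto
  ultimately show "isCont (\<lambda>(t, z). theta L t z) (t, z)" by (metis continuous_on_eq_continuous_at)
qed

lemma continuous_on_theta_partial_space: "t > 0 \<Longrightarrow> continuous_on S (theta_partial L N t)"
  using continuous_on_compose2[OF continuous_on_theta_partial[of L N], of S "\<lambda>z. (t, z)"]
    continuous_on_Pair[OF continuous_on_const continuous_on_id, of S t] by auto

lemma continuous_on_theta_space: "L > 0 \<Longrightarrow> t > 0 \<Longrightarrow> continuous_on S (theta L t)"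
  using continuous_on_compose2[OF continuous_on_theta[of L], of S "\<lambda>z. (t, z)"]
    continuous_on_Pair[OF continuous_on_const continuous_on_id, of S t] by auto

lemma theta_partial_uminus: "theta_partial L N t (- z) = theta_partial L N t z"
proof -
  have "gauss t (- z + c) = gauss t (z - c)" "gauss t (- z - c) = gauss t (z + c)" for c
    using gauss_uminus[of t "z - c"] gauss_uminus[of t "z + c"] by (simp_all del: gauss_uminus)
  then show ?thesis unfolding theta_partial_def by (simp add: add.commute)
qed

lemma theta_uminus:
  assumes "L > 0" "t > 0"
  shows "theta L t (- z) = theta L t z"
  using LIMSEQ_unique[OF theta_partial_tendsto[OF assms, of "- z"]] theta_partial_tendsto[OF assms, of z]
  by (simp add: theta_partial_uminus)

text \<open>The partial sum runs over the translates with index \<open>-N\<close> to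
  \<open>N\<close>; moving by one period gains index \<open>N + 1\<close> and loses index
  \<open>-N\<close>. Both terms vanish in the limit, hence periodicity.\<close>

lemma theta_partial_shift:
  "theta_partial L N t (z + 2 * L) = theta_partial L N t z
     + gauss t (z + 2 * L * real (Suc N)) - gauss t (z - 2 * L * real N)"
  by (induction N) (simp_all add: theta_partial_def algebra_simps)

lemma gauss_translates_tendsto_0:
  assumes "L > 0" "t > 0"
  shows "(\<lambda>n. gauss t (z + 2 * L * real (Suc n))) \<longlonglongrightarrow> 0"
    and "(\<lambda>n. gauss t (z - 2 * L * real (Suc n))) \<longlonglongrightarrow> 0"
proof -
  define C where "C = exp (\<bar>z\<bar>\<^sup>2 / (4 * t)) / sqrt (4 * pi * t)"
  define q where "q = exp (- (L\<^sup>2 / (2 * t)))"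
  have q: "0 < q" "q < 1" using assms by (auto simp: q_def)
  have "(\<lambda>n. C * q ^ Suc n) \<longlonglongrightarrow> C * 0"
    using q by (intro tendsto_mult tendsto_const LIMSEQ_Suc LIMSEQ_power_zero) auto
  then have lim: "(\<lambda>n. C * q ^ Suc n) \<longlonglongrightarrow> 0" by simp
  have bd: "gauss t (z + c) \<le> C * q ^ Suc n" if "\<bar>c\<bar> = 2 * L * real (Suc n)" for c n
    unfolding C_def q_def by (rule gauss_translate_bound[OF assms(2) _ _ _ that]) auto
  have bd': "gauss t (z - c) \<le> C * q ^ Suc n" if "c = 2 * L * real (Suc n)" for c n
    using bd[of "- c" n] that assms(1) by simp
  show "(\<lambda>n. gauss t (z + 2 * L * real (Suc n))) \<longlonglongrightarrow> 0"
    by (rule tendsto_sandwich[OF _ _ tendsto_const lim])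
      (use bd assms(1) gauss_nonneg[OF assms(2)] in \<open>auto intro!: always_eventually\<close>)
  show "(\<lambda>n. gauss t (z - 2 * L * real (Suc n))) \<longlonglongrightarrow> 0"
    by (rule tendsto_sandwich[OF _ _ tendsto_const lim])
      (use bd' gauss_nonneg[OF assms(2)] in \<open>auto intro!: always_eventually\<close>)
qed

lemma theta_periodic:
  assumes "L > 0" "t > 0"
  shows "theta L t (z + 2 * L) = theta L t z"
proof (rule LIMSEQ_unique[OF theta_partial_tendsto[OF assms]])
  have "(\<lambda>N. gauss t (z - 2 * L * real N)) \<longlonglongrightarrow> 0"
    using gauss_translates_tendsto_0(2)[OF assms] by (rule LIMSEQ_imp_Suc)
  then have "(\<lambda>N. theta_partial L N t z + gauss t (z + 2 * L * real (Suc N)) - gauss t (z - 2 * L * real N))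
      \<longlonglongrightarrow> theta L t z + 0 - 0"
    by (intro tendsto_intros theta_partial_tendsto gauss_translates_tendsto_0 assms)
  then show "(\<lambda>N. theta_partial L N t (z + 2 * L)) \<longlonglongrightarrow> theta L t z"
    by (simp add: theta_partial_shift)
qed

text \<open>All shifted Gaussians together are bounded by a geometric series with ratio
  \<open>exp (- (L\<^sup>2 / (2 * t)))\<close>, and this exponential smallness beats the factor
  \<open>1 / sqrt (4 * pi * t)\<close>.\<close>

lemma theta_zero_asymptotic:
  assumes L: "L > 0"
  shows "((\<lambda>t. L * theta L t 0 - L / sqrt (4 * pi * t)) \<longlongrightarrow> 0) (at_right 0)"
proof -
  have lim: "((\<lambda>t. 2 * (1 / sqrt (4 * pi * t)) * (exp (- (k / t)) / (1 - exp (- (k / t))))) \<longlongrightarrow> 0) (at_right 0)"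
    if "k > 0" for k :: real
    using that by real_asymp
  have bound: "\<bar>theta L t 0 - gauss t 0\<bar> \<le> 2 * (1 / sqrt (4 * pi * t)) * (exp (- (L\<^sup>2 / (2 * t))) / (1 - exp (- (L\<^sup>2 / (2 * t)))))"
    if t: "t > 0" for t
  proof -
    define C where "C = 1 / sqrt (4 * pi * t)"
    define q where "q = exp (- (L\<^sup>2 / (2 * t)))"
    have q: "0 < q" "q < 1" using L t by (auto simp: q_def)
    define g where "g = (\<lambda>n. gauss t (0 + 2 * L * real (Suc n)) + gauss t (0 - 2 * L * real (Suc n)))"
    have g0: "g n \<ge> 0" for n unfolding g_def using gauss_nonneg[OF t] by simp
    \<comment> \<open>The translate bound with \<open>R = 0\<close> and \<open>a = b = t\<close>:
      here its constants must follow \<open>t\<close> to 0, so no fixed time window is used.\<close>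
    have "gauss t (0 + c) \<le> C * q ^ Suc n" if "\<bar>c\<bar> = 2 * L * real (Suc n)" for c n
      using gauss_translate_bound[OF t order_refl order_refl _ that, of 0 0] by (simp add: C_def q_def)
    then have tr: "gauss t c \<le> C * q ^ Suc n" if "\<bar>c\<bar> = 2 * L * real (Suc n)" for c n
      using that by (simp only: add_0)
    have gle: "g n \<le> 2 * C * q ^ Suc n" for n
    proof -
      have "gauss t (2 * L * real (Suc n)) \<le> C * q ^ Suc n" "gauss t (- (2 * L * real (Suc n))) \<le> C * q ^ Suc n"
        by (rule tr; use L in simp)+
      then show ?thesis unfolding g_def by (simp only: add_0 diff_0)
    qed
    have S: "(\<lambda>n. q ^ Suc n) sums (q / (1 - q))"
      using sums_mult[OF geometric_sums[of q], of q] q by simp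
    then have S2: "(\<lambda>n. 2 * C * q ^ Suc n) sums (2 * C * (q / (1 - q)))" by (rule sums_mult)
    have sg: "summable g"
      by (rule summable_comparison_test[OF _ sums_summable[OF S2]]) (use g0 gle in auto)
    have "suminf g \<le> 2 * C * (q / (1 - q))"
      using suminf_le[OF gle sg sums_summable[OF S2]] sums_unique[OF S2] by simp
    moreover have "suminf g \<ge> 0" using suminf_nonneg[OF sg] g0 by simp
    moreover have "theta L t 0 - gauss t 0 = suminf g" by (simp add: theta_def g_def)
    ultimately show ?thesis by (simp only: C_def q_def abs_of_nonneg)
  qed
  have "((\<lambda>t. 2 * (1 / sqrt (4 * pi * t)) * (exp (- (L\<^sup>2 / (2 * t))) / (1 - exp (- (L\<^sup>2 / (2 * t)))))) \<longlongrightarrow> 0) (at_right 0)"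
    using lim[of "L\<^sup>2 / 2"] L by simp
  moreover have "eventually (\<lambda>t. norm (theta L t 0 - gauss t 0) \<le> 2 * (1 / sqrt (4 * pi * t)) * (exp (- (L\<^sup>2 / (2 * t))) / (1 - exp (- (L\<^sup>2 / (2 * t)))))) (at_right 0)"
    using eventually_at_right_less[of "0::real"] by (rule eventually_mono) (unfold real_norm_def, rule bound)
  ultimately have "((\<lambda>t. theta L t 0 - gauss t 0) \<longlongrightarrow> 0) (at_right 0)"
    by (rule Lim_null_comparison[rotated])
  then have "((\<lambda>t. L * (theta L t 0 - gauss t 0)) \<longlongrightarrow> L * 0) (at_right 0)"
    by (intro tendsto_intros)
  then show ?thesis by (simp add: gauss_def algebra_simps)
qed

section \<open>Folding the line onto the interval\<close>

lemma integral_add_continuous3: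
  fixes f g h :: "real \<Rightarrow> real"
  assumes "continuous_on {a..b} f" "continuous_on {a..b} g" "continuous_on {a..b} h"
  shows "integral {a..b} f + (integral {a..b} g + integral {a..b} h) = integral {a..b} (\<lambda>x. f x + (g x + h x))"
  using assms[THEN integrable_continuous_real] by (simp add: integral_add integrable_add)

lemma integral_uniform_limit:
  fixes f :: "nat \<Rightarrow> real \<Rightarrow> real"
  assumes u: "uniform_limit {a..b} f g sequentially" and c: "\<And>n. continuous_on {a..b} (f n)"
  shows "(\<lambda>n. integral {a..b} (f n)) \<longlonglongrightarrow> integral {a..b} g"
proof -
  obtain I J where I: "\<And>n. (f n has_integral I n) {a..b}" and J: "(g has_integral J) {a..b}" and "I \<longlonglongrightarrow> J"
    using uniform_limit_integral[OF u c sequentially_bot] by blast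
  then show ?thesis unfolding integral_unique[OF I] integral_unique[OF J] by simp
qed

lemma integral_fold_window:
  fixes H :: "real \<Rightarrow> real"
  assumes H: "continuous_on UNIV H" and L: "L \<ge> 0"
  shows "integral {c - L..c + L} H = integral {0..L} (\<lambda>y. H (c + y) + H (c - y))"
proof -
  have int: "H integrable_on {a..b}" for a b
    by (intro integrable_continuous_real continuous_on_subset[OF H]) auto
  have cont: "continuous_on S (\<lambda>y. H (c + y))" "continuous_on S (\<lambda>y. H (c - y))" for S
    by (auto intro!: continuous_on_compose2[OF H] continuous_intros)
  have "integral {c - L..c + L} H = integral {c - L..c} H + integral {c..c + L} H"
    using L by (intro Henstock_Kurzweil_Integration.integral_combine[symmetric] int) auto
  also have "integral {c..c + L} H = integral {0..L} (\<lambda>y. H (c + y))"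
    using integral_shift_real_ivl[of c c "c + L" H] by (simp add: add.commute)
  also have "integral {c - L..c} H = integral {-L..-0} (\<lambda>y. H (c - (- y)))"
    using integral_shift_real_ivl[of "c - L" c c H] by (simp add: add.commute)
  also have "\<dots> = integral {0..L} (\<lambda>y. H (c - y))"
    by (rule Henstock_Kurzweil_Integration.integral_reflect_real)
  also have "integral {0..L} (\<lambda>y. H (c - y)) + integral {0..L} (\<lambda>y. H (c + y))
      = integral {0..L} (\<lambda>y. H (c + y) + H (c - y))"
    by (subst integral_add) (auto intro!: integrable_continuous_real cont)
  finally show ?thesis .
qed

text \<open>The symmetric interval consists of \<open>2 * N + 1\<close> windows of length
  \<open>2 * L\<close> centred at the multiples of \<open>2 * L\<close>, each folded at its centre.
  The odd extension is odd about these centres, so every window will contribute one direct and one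
  reflected image.\<close>

lemma integral_fold_line:
  fixes H :: "real \<Rightarrow> real"
  assumes H: "continuous_on UNIV H" and L: "L \<ge> 0"
  shows "integral {- (2 * real N + 1) * L..(2 * real N + 1) * L} H
    = integral {0..L} (\<lambda>y. H y + H (- y) + (\<Sum>n<N. (H (2 * L * real (Suc n) + y) + H (2 * L * real (Suc n) - y))
        + (H (- (2 * L * real (Suc n)) + y) + H (- (2 * L * real (Suc n)) - y))))"
proof (induction N)
  case 0
  show ?case using integral_fold_window[OF H L, of 0] by simp
next
  case (Suc N)
  define c where "c = 2 * L * real (Suc N)"
  define S where "S = (\<lambda>N y. H y + H (- y) + (\<Sum>n<N. (H (2 * L * real (Suc n) + y) + H (2 * L * real (Suc n) - y))
        + (H (- (2 * L * real (Suc n)) + y) + H (- (2 * L * real (Suc n)) - y))))"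
  have int: "H integrable_on {a..b}" for a b
    by (intro integrable_continuous_real continuous_on_subset[OF H]) auto
  have cont: "continuous_on {0..L} (\<lambda>y. H (c + y))" "continuous_on {0..L} (\<lambda>y. H (c - y))" for c
    by (auto intro!: continuous_on_compose2[OF H] continuous_intros)
  have contS: "continuous_on {0..L} (S N)" unfolding S_def
    by (intro continuous_intros cont continuous_on_subset[OF H] continuous_on_compose2[OF H]) auto
  have e: "- (2 * real (Suc N) + 1) * L = - c - L" "- (2 * real N + 1) * L = - c + L"
    "(2 * real N + 1) * L = c - L" "(2 * real (Suc N) + 1) * L = c + L"
    by (simp_all add: c_def algebra_simps)
  have cL: "c \<ge> L + L" using L by (simp add: c_def algebra_simps)
  have "integral {- c - L..c + L} H = integral {- c - L..- c + L} H + integral {- c + L..c + L} H"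
    using L cL by (intro Henstock_Kurzweil_Integration.integral_combine[symmetric] int) auto
  also have "integral {- c + L..c + L} H = integral {- c + L..c - L} H + integral {c - L..c + L} H"
    using L cL by (intro Henstock_Kurzweil_Integration.integral_combine[symmetric] int) auto
  also have "integral {- c + L..c - L} H = integral {0..L} (S N)"
    using Suc.IH unfolding e S_def .
  also have "integral {- c - L..- c + L} H + (integral {0..L} (S N) + integral {c - L..c + L} H)
      = integral {0..L} (\<lambda>y. (H (- c + y) + H (- c - y)) + (S N y + (H (c + y) + H (c - y))))"
    unfolding integral_fold_window[OF H L]
    by (intro integral_add_continuous3 continuous_on_add cont contS)
  also have "(\<lambda>y. (H (- c + y) + H (- c - y)) + (S N y + (H (c + y) + H (c - y)))) = S (Suc N)"
    by (simp add: S_def c_def fun_eq_iff)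
  finally show ?case unfolding e S_def .
qed

section \<open>The odd periodic extension of the initial datum\<close>

lemma continuous_on_sgn_mult:
  fixes s g :: "real \<Rightarrow> real"
  assumes s: "continuous_on UNIV s" and g: "continuous_on UNIV g" and zero: "\<And>z. s z = 0 \<Longrightarrow> g z = 0"
  shows "continuous_on UNIV (\<lambda>z. sgn (s z) * g z)"
proof (rule continuous_at_imp_continuous_on, rule ballI)
  fix z
  have st: "(s \<longlongrightarrow> s z) (at z)" and gt: "(g \<longlongrightarrow> g z) (at z)"
    using s g by (auto simp: continuous_on_def)
  show "isCont (\<lambda>z. sgn (s z) * g z) z"
  proof (cases "s z = 0")
    case False
    then show ?thesis unfolding isCont_def by (intro tendsto_mult tendsto_sgn st gt)
  next
    case True
    \<comment> \<open>The sign can jump only at zeros of \<open>s\<close>; there the product is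
      squeezed by \<open>\<bar>g z\<bar>\<close>, which tends to 0.\<close>
    with zero gt have "((\<lambda>z. \<bar>g z\<bar>) \<longlongrightarrow> 0) (at z)" by (intro tendsto_rabs_zero) simp
    then have "((\<lambda>z. sgn (s z) * g z) \<longlongrightarrow> 0) (at z)"
      by (rule Lim_null_comparison[rotated]) (auto intro!: always_eventually simp: abs_mult sgn_if)
    then show ?thesis using True by (simp add: isCont_def)
  qed
qed

text \<open>The argument of \<open>f\<close> is the triangle wave of period \<open>2 * L\<close> that equals \<open>z\<close> on \<open>[0, L]\<close>, and the
  sign of the sine makes the extension odd; this closed form is visibly continuous and periodic.\<close>

definition odd_extension :: "real \<Rightarrow> (real \<Rightarrow> real) \<Rightarrow> real \<Rightarrow> real" where
  "odd_extension L f z = sgn (sin (pi * z / L)) * f (L / pi * arccos (cos (pi * z / L)))"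

context
  fixes L :: real and f :: "real \<Rightarrow> real"
  assumes L: "L > 0" and f: "continuous_on {0..L} f" and f0: "f 0 = 0" and fL: "f L = 0"
begin

lemma triangle_wave_range: "L / pi * arccos (cos w) \<in> {0..L}"
proof -
  have "0 \<le> arccos (cos w)" "arccos (cos w) \<le> pi"
    using arccos_lbound arccos_ubound by (auto simp: cos_ge_minus_one)
  then have "L / pi * arccos (cos w) \<le> L / pi * pi" "0 \<le> L / pi * arccos (cos w)"
    using L by (auto intro!: mult_left_mono simp del: times_divide_eq_left)
  then show ?thesis by simp
qed

lemma odd_extension_continuous: "continuous_on UNIV (odd_extension L f)"
  unfolding odd_extension_def[abs_def]
proof (rule continuous_on_sgn_mult)
  show "continuous_on UNIV (\<lambda>z. sin (pi * z / L))" using L by (intro continuous_intros) auto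
  show "continuous_on UNIV (\<lambda>z. f (L / pi * arccos (cos (pi * z / L))))"
  proof (rule continuous_on_compose2[OF f])
    show "continuous_on UNIV (\<lambda>z. L / pi * arccos (cos (pi * z / L)))"
      using L by (intro continuous_intros) auto
  qed (use triangle_wave_range in auto)
  \<comment> \<open>Where the sine vanishes the triangle wave is at \<open>0\<close> or
    \<open>L\<close>, so the boundary values of \<open>f\<close> cancel the jump of the
    sign.\<close>
  fix z assume "sin (pi * z / L) = 0"
  then have "(cos (pi * z / L))\<^sup>2 = 1" using sin_cos_squared_add[of "pi * z / L"] by simp
  then have "cos (pi * z / L) = 1 \<or> cos (pi * z / L) = - 1" by (simp add: power2_eq_1_iff)
  then show "f (L / pi * arccos (cos (pi * z / L))) = 0" using f0 fL by auto
qed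

lemma odd_extension_bounded: "\<exists>B. \<forall>z. \<bar>odd_extension L f z\<bar> \<le> B"
proof -
  have "compact (f ` {0..L})" using f by (intro compact_continuous_image) auto
  then obtain B where B: "\<And>y. y \<in> {0..L} \<Longrightarrow> \<bar>f y\<bar> \<le> B"
    by (meson bounded_real compact_imp_bounded imageI)
  have "\<bar>odd_extension L f z\<bar> \<le> B" for z
  proof -
    have "\<bar>odd_extension L f z\<bar> \<le> \<bar>f (L / pi * arccos (cos (pi * z / L)))\<bar>"
      by (simp add: odd_extension_def abs_mult sgn_if)
    also have "\<dots> \<le> B" by (rule B[OF triangle_wave_range])
    finally show ?thesis .
  qed
  then show ?thesis by blast
qed

text \<open>Every real number has one of these two forms, so they determine the extension; beyond
  them, later arguments need only its continuity and boundedness.\<close>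

lemma odd_extension_translate:
  assumes y: "y \<in> {0..L}"
  shows "odd_extension L f (2 * L * of_int m + y) = f y"
    and "odd_extension L f (2 * L * of_int m - y) = - f y"
proof -
  define w where "w = pi * y / L"
  have w: "0 \<le> w" "w \<le> pi" using y L by (auto simp: w_def divide_le_eq)
  have e: "pi * (2 * L * of_int m + y) / L = w + 2 * pi * of_int m"
    "pi * (2 * L * of_int m - y) / L = - w + 2 * pi * of_int m"
    using L by (simp_all add: w_def field_simps)
  have per: "sin (v + 2 * pi * of_int m) = sin v" "cos (v + 2 * pi * of_int m) = cos v" for v :: real
    by (simp_all add: sin_add cos_add)
  have arg: "L / pi * arccos (cos w) = y" using w L by (simp add: arccos_cos w_def)
  \<comment> \<open>The sign is 1 in the interior; at the endpoints it is 0, but so is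
    \<open>f y\<close>.\<close>
  have s: "sgn (sin w) * f y = f y"
  proof (cases "y = 0 \<or> y = L")
    case False
    then have "0 < w" "w < pi" using y L by (auto simp: w_def divide_less_eq)
    then show ?thesis using sin_gt_zero by simp
  qed (use f0 fL in auto)
  show "odd_extension L f (2 * L * of_int m + y) = f y"
    unfolding odd_extension_def e per arg by (rule s)
  show "odd_extension L f (2 * L * of_int m - y) = - f y"
    unfolding odd_extension_def e per cos_minus arg sin_minus sgn_minus using s by simp
qed

text \<open>The method of images. The integrals over the growing windows are evaluated in two ways:
  they exhaust the line, and after folding they are integrals over \<open>{0..L}\<close> against
  partial theta sums, which converge uniformly.\<close>

lemma heat_line_odd_extension:
  assumes t: "t > 0"
  shows "(\<integral>z. gauss t (x - z) * odd_extension L f z \<partial>lborel)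
    = integral {0..L} (\<lambda>y. (theta L t (x - y) - theta L t (x + y)) * f y)"
proof (rule LIMSEQ_unique)
  define F where "F = odd_extension L f"
  define H where "H = (\<lambda>z. gauss t (x - z) * F z)"
  obtain B where B: "\<And>z. \<bar>F z\<bar> \<le> B" using odd_extension_bounded unfolding F_def by blast
  have F: "continuous_on UNIV F" unfolding F_def by (rule odd_extension_continuous)
  have g: "continuous_on S (gauss t)" for S
    using t unfolding gauss_def[abs_def] by (intro continuous_intros) auto
  have H: "continuous_on UNIV H" unfolding H_def
    by (intro continuous_intros F continuous_on_compose2[OF g[of UNIV]]) auto
  have intH: "integrable lborel H" unfolding H_def
    using lborel_integrable_real_affine[OF integrable_gauss[OF t], of "-1" x] gauss_nonneg[OF t]
    by (intro integrable_gauss_convolution[OF F B, of "\<lambda>z. gauss t (x - z)"]) auto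
  have "(\<lambda>N. integral {- (2 * real N + 1) * L..(2 * real N + 1) * L} H) \<longlonglongrightarrow> (\<integral>z. H z \<partial>lborel)"
  proof (rule integral_tendsto_whole_line[OF H intH])
    show "filterlim (\<lambda>N. (2 * real N + 1) * L) at_top sequentially" using L by real_asymp
    show "filterlim (\<lambda>N. - (2 * real N + 1) * L) at_bot sequentially" using L by real_asymp
  qed
  moreover have "integral {- (2 * real N + 1) * L..(2 * real N + 1) * L} H
    = integral {0..L} (\<lambda>y. (theta_partial L N t (x - y) - theta_partial L N t (x + y)) * f y)" for N
    unfolding integral_fold_line[OF H less_imp_le[OF L]]
  proof (rule integral_cong)
    fix y assume y: "y \<in> {0..L}"
    note tr = odd_extension_translate[OF y, folded F_def]
    have H0: "H y = gauss t (x - y) * f y" "H (- y) = - gauss t (x + y) * f y"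
      using tr[of 0] by (simp_all add: H_def)
    have Hp: "H (c + y) = gauss t (x - y - c) * f y" "H (c - y) = - gauss t (x + y - c) * f y"
      if "c = 2 * L * of_int m" for c m
      using tr[of m] that by (simp_all add: H_def algebra_simps)
    have H1: "H (2 * L * real (Suc n) + y) = gauss t (x - y - 2 * L * real (Suc n)) * f y"
      "H (2 * L * real (Suc n) - y) = - gauss t (x + y - 2 * L * real (Suc n)) * f y" for n
      by (rule Hp[of _ "int (Suc n)"]; simp)+
    have H2: "H (- (2 * L * real (Suc n)) + y) = gauss t (x - y + 2 * L * real (Suc n)) * f y"
      "H (- (2 * L * real (Suc n)) - y) = - gauss t (x + y + 2 * L * real (Suc n)) * f y" for n
    proof -
      \<comment> \<open>Negative centres are translates with negative integer index, so the same
        rule \<open>Hp\<close> covers them.\<close>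
      have e: "- (2 * L * real (Suc n)) = 2 * L * of_int (- int (Suc n))" by (simp add: algebra_simps)
      show "H (- (2 * L * real (Suc n)) + y) = gauss t (x - y + 2 * L * real (Suc n)) * f y"
        "H (- (2 * L * real (Suc n)) - y) = - gauss t (x + y + 2 * L * real (Suc n)) * f y"
        using Hp[OF e] by (simp_all only: diff_minus_eq_add)
    qed
    show "H y + H (- y) + (\<Sum>n<N. (H (2 * L * real (Suc n) + y) + H (2 * L * real (Suc n) - y))
        + (H (- (2 * L * real (Suc n)) + y) + H (- (2 * L * real (Suc n)) - y)))
      = (theta_partial L N t (x - y) - theta_partial L N t (x + y)) * f y"
      unfolding H0 H1 H2 theta_partial_def
      by (simp only: left_diff_distrib distrib_right sum_distrib_right sum.distrib sum_negf mult_minus_left)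
  qed
  ultimately show "(\<lambda>N. integral {0..L} (\<lambda>y. (theta_partial L N t (x - y) - theta_partial L N t (x + y)) * f y))
      \<longlonglongrightarrow> (\<integral>z. gauss t (x - z) * odd_extension L f z \<partial>lborel)"
    by (simp add: H_def F_def)
  define K where "K = (\<lambda>y. theta L t (x - y) - theta L t (x + y))"
  define KN where "KN = (\<lambda>N y. theta_partial L N t (x - y) - theta_partial L N t (x + y))"
  have un: "uniform_limit {0..L} (\<lambda>N y. theta_partial L N t (w y)) (\<lambda>y. theta L t (w y)) sequentially"
    if "w \<in> {0..L} \<rightarrow> {- (\<bar>x\<bar> + L)..\<bar>x\<bar> + L}" for w
    using uniform_limit_compose'[OF theta_uniform_limit_space[OF L t] that] .
  have unif: "uniform_limit {0..L} KN K sequentially"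
    unfolding KN_def K_def by (intro uniform_limit_minus un) auto
  have "continuous_on {0..L} K" unfolding K_def
    by (intro continuous_intros continuous_on_compose2[OF continuous_on_theta_space[OF L t, of UNIV]]) auto
  then have "bounded (K ` {0..L})" by (intro compact_imp_bounded compact_continuous_image) auto
  moreover have "bounded (f ` {0..L})" using f by (intro compact_imp_bounded compact_continuous_image) auto
  \<comment> \<open>Products preserve uniform convergence when the limits are bounded, hence the two
    boundedness facts.\<close>
  ultimately have "uniform_limit {0..L} (\<lambda>N y. KN N y * f y) (\<lambda>y. K y * f y) sequentially"
    by (intro uniform_lim_mult unif uniform_limit_const)
  moreover have "continuous_on {0..L} (\<lambda>y. KN N y * f y)" for N unfolding KN_def
    by (intro continuous_intros f continuous_on_compose2[OF continuous_on_theta_partial_space[OF t, of UNIV]]) auto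
  ultimately have "(\<lambda>N. integral {0..L} (\<lambda>y. KN N y * f y)) \<longlonglongrightarrow> integral {0..L} (\<lambda>y. K y * f y)"
    by (rule integral_uniform_limit)
  then show "(\<lambda>N. integral {0..L} (\<lambda>y. (theta_partial L N t (x - y) - theta_partial L N t (x + y)) * f y))
      \<longlonglongrightarrow> integral {0..L} (\<lambda>y. (theta L t (x - y) - theta L t (x + y)) * f y)"
    by (simp add: K_def KN_def)
qed

end

text \<open>The map \<open>x \<mapsto> 2 * x\<close> turns the period \<open>2 * L\<close> into
  \<open>L\<close>, so the translates of \<open>{0..L}\<close> tile the line without reflections,
  and the integral unfolds to that of \<open>gauss t (2 * z)\<close>, where the scaling produces
  \<open>1 / 2\<close>.\<close>

lemma integral_theta_double:
  assumes L: "L > 0" and t: "t > 0"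
  shows "integral {0..L} (\<lambda>x. theta L t (2 * x)) = 1 / 2"
proof (rule LIMSEQ_unique)
  define H where "H = (\<lambda>z. gauss t (2 * z))"
  have g: "continuous_on UNIV (gauss t)"
    using t unfolding gauss_def[abs_def] by (intro continuous_intros) auto
  have H: "continuous_on UNIV H" unfolding H_def
    by (intro continuous_on_compose2[OF g] continuous_intros) auto
  have int: "H integrable_on {a..b}" for a b
    by (intro integrable_continuous_real continuous_on_subset[OF H]) auto
  have cH: "continuous_on S (\<lambda>y. H (y + c))" for S c
    by (intro continuous_on_compose2[OF H] continuous_intros) auto
  have intH: "integrable lborel H"
    using lborel_integrable_real_affine[OF integrable_gauss[OF t], of 2 0] by (simp add: H_def)
  have "(\<integral>z. H z \<partial>lborel) = 1 / 2"
    using lborel_integral_real_affine[of 2 "gauss t" 0] integral_gauss[OF t] by (simp add: H_def)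
  \<comment> \<open>The window is not symmetric: its \<open>2 * N + 1\<close> tiles have left
    endpoints from \<open>- N * L\<close> to \<open>N * L\<close>.\<close>
  moreover have "(\<lambda>N. integral {- real N * L..(real N + 1) * L} H) \<longlonglongrightarrow> (\<integral>z. H z \<partial>lborel)"
  proof (rule integral_tendsto_whole_line[OF H intH])
    show "filterlim (\<lambda>N. (real N + 1) * L) at_top sequentially" using L by real_asymp
    show "filterlim (\<lambda>N. - real N * L) at_bot sequentially" using L by real_asymp
  qed
  moreover have "integral {- real N * L..(real N + 1) * L} H = integral {0..L} (\<lambda>x. theta_partial L N t (2 * x))" for N
  proof (induction N)
    case 0
    show ?case by (simp add: theta_partial_def H_def)
  next
    case (Suc N)
    define c where "c = L * real (Suc N)"
    have e: "- real (Suc N) * L = - c" "(real (Suc N) + 1) * L = c + L" "- real N * L = - c + L" "(real N + 1) * L = c"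
      by (simp_all add: c_def algebra_simps)
    have c: "c \<ge> L" using L by (simp add: c_def algebra_simps)
    have cp: "continuous_on {0..L} (\<lambda>x. theta_partial L N t (2 * x))"
      by (intro continuous_on_compose2[OF continuous_on_theta_partial_space[OF t, of UNIV]] continuous_intros) auto
    have "integral {- c..c + L} H = integral {- c..- c + L} H + integral {- c + L..c + L} H"
      using L c by (intro Henstock_Kurzweil_Integration.integral_combine[symmetric] int) auto
    also have "integral {- c + L..c + L} H = integral {- c + L..c} H + integral {c..c + L} H"
      using L c by (intro Henstock_Kurzweil_Integration.integral_combine[symmetric] int) auto
    also have "integral {- c + L..c} H = integral {0..L} (\<lambda>x. theta_partial L N t (2 * x))"
      using Suc.IH unfolding e .
    also have "integral {c..c + L} H = integral {0..L} (\<lambda>y. H (y + c))"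
      using integral_shift_real_ivl[of c c "c + L" H] by simp
    also have "integral {- c..- c + L} H = integral {0..L} (\<lambda>y. H (y + - c))"
      using integral_shift_real_ivl[of "- c" "- c" "- c + L" H] by simp
    also have "integral {0..L} (\<lambda>y. H (y + - c)) + (integral {0..L} (\<lambda>x. theta_partial L N t (2 * x)) + integral {0..L} (\<lambda>y. H (y + c)))
      = integral {0..L} (\<lambda>y. H (y + - c) + (theta_partial L N t (2 * y) + H (y + c)))"
      by (intro integral_add_continuous3 cH cp)
    also have "(\<lambda>y. H (y + - c) + (theta_partial L N t (2 * y) + H (y + c))) = (\<lambda>y. theta_partial L (Suc N) t (2 * y))"
    proof
      fix y
      have "2 * (y + - c) = 2 * y - 2 * L * real (Suc N)" "2 * (y + c) = 2 * y + 2 * L * real (Suc N)"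
        by (simp_all add: c_def algebra_simps)
      then show "H (y + - c) + (theta_partial L N t (2 * y) + H (y + c)) = theta_partial L (Suc N) t (2 * y)"
        unfolding H_def theta_partial_def by (simp only: sum.lessThan_Suc add_ac)
    qed
    finally show ?case unfolding e .
  qed
  ultimately show "(\<lambda>N. integral {0..L} (\<lambda>x. theta_partial L N t (2 * x))) \<longlonglongrightarrow> 1 / 2" by (simp only:)
  have "uniform_limit {0..L} (\<lambda>N x. theta_partial L N t (2 * x)) (\<lambda>x. theta L t (2 * x)) sequentially"
    by (rule uniform_limit_compose'[OF theta_uniform_limit_space[OF L t, of "2 * L"]]) (use L in auto)
  moreover have "continuous_on {0..L} (\<lambda>x. theta_partial L N t (2 * x))" for N
    by (intro continuous_on_compose2[OF continuous_on_theta_partial_space[OF t, of UNIV]] continuous_intros) auto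
  ultimately show "(\<lambda>N. integral {0..L} (\<lambda>x. theta_partial L N t (2 * x))) \<longlonglongrightarrow> integral {0..L} (\<lambda>x. theta L t (2 * x))"
    by (rule integral_uniform_limit)
qed

section \<open>The Dirichlet heat kernel of an interval\<close>

definition image_kernel :: "real \<Rightarrow> real \<Rightarrow> real \<Rightarrow> real \<Rightarrow> real" where
  "image_kernel L t x y = (if t > 0 \<and> x \<in> {0<..<L} \<and> y \<in> {0<..<L} then theta L t (x - y) - theta L t (x + y) else 0)"

text \<open>Evenness about 0 and period \<open>2 * L\<close> give evenness about \<open>L\<close>,
  the reflection principle at the right endpoint.\<close>

lemma theta_reflect:
  assumes "L > 0" "t > 0"
  shows "theta L t (L - y) = theta L t (L + y)"
  using theta_uminus[OF assms, of "L - y"] theta_periodic[OF assms, of "y - L"] by (simp add: algebra_simps)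

text \<open>The theta difference vanishes by itself when either variable is an endpoint, so the
  cut-off in the definition creates no discontinuity on the closed square.\<close>

lemma image_kernel_eq:
  assumes L: "L > 0" and t: "t > 0" and x: "x \<in> {0..L}" and y: "y \<in> {0..L}"
  shows "image_kernel L t x y = theta L t (x - y) - theta L t (x + y)"
proof -
  consider "x \<in> {0<..<L} \<and> y \<in> {0<..<L}" | "x = 0" | "x = L" | "y = 0" | "y = L" using x y by force
  then show ?thesis
  proof cases
    case 5
    then show ?thesis
      using theta_reflect[OF L t, of x] theta_uminus[OF L t, of "x - L"] by (simp add: image_kernel_def add.commute)
  qed (use t theta_uminus[OF L t, of y] theta_reflect[OF L t, of y] in \<open>auto simp: image_kernel_def\<close>)
qed

text \<open>\<open>u_pos\<close> identifies the interval integral with the line convolution, which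
  supplies the derivatives; \<open>u_V\<close> identifies it with the rescaled average, which
  supplies continuity up to \<open>t = 0\<close>.\<close>

lemma image_kernel_solution:
  assumes L: "L > 0" and f: "continuous_on {0..L} f" and f0: "f 0 = 0" and fL: "f L = 0"
  shows "dirichlet_heat_solution {0<..<L} f
    (\<lambda>t x. if t = 0 then f x else (LINT y:{0<..<L}|lborel. image_kernel L t x y * f y))"
    (is "dirichlet_heat_solution _ _ ?u")
proof -
  define F where "F = odd_extension L f"
  define V where "V = (\<lambda>t x. \<integral>w. std_normal_density w * F (x + sqrt (2 * t) * w) \<partial>lborel)"
  obtain B where B: "\<And>z. \<bar>F z\<bar> \<le> B" using odd_extension_bounded[OF L f f0 fL] unfolding F_def by blast
  have F: "continuous_on UNIV F" unfolding F_def by (rule odd_extension_continuous[OF L f f0 fL])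
  have cl: "closure {0<..<L} = {0..L}" using L by simp
  have fr: "frontier {0<..<L} = {0, L}" using L by (auto simp: frontier_def)
  have u_pos: "?u t x = (\<integral>z. gauss t (x - z) * F z \<partial>lborel)" if t: "t > 0" and x: "x \<in> {0..L}" for t x
  proof -
    define K where "K = (\<lambda>y. (theta L t (x - y) - theta L t (x + y)) * f y)"
    have "continuous_on {0..L} K" unfolding K_def
      by (intro continuous_intros f continuous_on_compose2[OF continuous_on_theta_space[OF L t, of UNIV]]) auto
    then have "set_integrable lborel {0..L} K"
      unfolding set_integrable_def by (intro borel_integrable_compact) auto
    then have *: "set_integrable lborel {0<..<L} K" by (rule set_integrable_subset) auto
    have "?u t x = (LINT y:{0<..<L}|lborel. image_kernel L t x y * f y)" using t by simp
    also have "\<dots> = (LINT y:{0<..<L}|lborel. K y)"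
      using image_kernel_eq[OF L t x] by (intro set_lebesgue_integral_cong) (auto simp: K_def)
    also have "\<dots> = integral {0..L} K"
      using set_borel_integral_eq_integral(2)[OF *] by (simp add: integral_open_interval_real)
    also have "\<dots> = (\<integral>z. gauss t (x - z) * F z \<partial>lborel)"
      unfolding K_def F_def by (rule heat_line_odd_extension[OF L f f0 fL t, symmetric])
    finally show ?thesis .
  qed
  have u_V: "?u t x = V t x" if t: "t \<ge> 0" and x: "x \<in> {0..L}" for t x
  proof (cases "t = 0")
    case True
    \<comment> \<open>At \<open>t = 0\<close> the argument of \<open>F\<close> is constant in
      \<open>w\<close>, and the standard normal density has total mass one.\<close>
    have "V 0 x = F x" by (simp add: V_def)
    also have "\<dots> = f x" using odd_extension_translate(1)[OF L f f0 fL x, of 0] by (simp add: F_def)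
    finally show ?thesis using True by simp
  next
    case False
    then have "t > 0" using t by simp
    then show ?thesis unfolding V_def heat_line_rescaled[OF F B \<open>t > 0\<close>, symmetric] by (rule u_pos[OF _ x])
  qed
  have "continuous_on ({0..} \<times> {0..L}) (\<lambda>(t, x). V t x)"
    by (rule continuous_on_subset[OF heat_line_continuous[OF F B, folded V_def]]) auto
  then have "continuous_on ({0..} \<times> {0..L}) (\<lambda>(t, x). ?u t x)"
    by (rule continuous_on_eq) (use u_V in auto)
  moreover have "\<forall>t\<ge>0. \<forall>x\<in>{0, L}. ?u t x = 0" using f0 fL by (auto simp: image_kernel_def)
  moreover have "((\<lambda>s. ?u s x) has_real_derivative (\<integral>z. gauss_xx t (x - z) * F z \<partial>lborel)) (at t) \<and>
        (?u t has_real_derivative (\<integral>z. gauss_x t (x - z) * F z \<partial>lborel)) (at x) \<and>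
        ((\<lambda>x. \<integral>z. gauss_x t (x - z) * F z \<partial>lborel) has_real_derivative (\<integral>z. gauss_xx t (x - z) * F z \<partial>lborel)) (at x)"
    if t: "t > 0" and x: "x \<in> {0<..<L}" for t x
  proof (intro conjI)
    note d = heat_line_derivatives[OF F B t, of x]
    show "((\<lambda>s. ?u s x) has_real_derivative (\<integral>z. gauss_xx t (x - z) * F z \<partial>lborel)) (at t)"
      \<comment> \<open>The two formulas agree only for positive times and \<open>x\<close> in the
        closed interval, so the derivative is transferred on an open set.\<close>
      by (rule has_field_derivative_transform_within_open[OF d(1), of "{0<..}"]) (use t x u_pos in auto)
    show "(?u t has_real_derivative (\<integral>z. gauss_x t (x - z) * F z \<partial>lborel)) (at x)"
      by (rule has_field_derivative_transform_within_open[OF d(2), of "{0<..<L}"]) (use t x u_pos in auto)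
    show "((\<lambda>x. \<integral>z. gauss_x t (x - z) * F z \<partial>lborel) has_real_derivative (\<integral>z. gauss_xx t (x - z) * F z \<partial>lborel)) (at x)"
      by (rule d(3))
  qed
  then have "\<exists>u\<^sub>t u\<^sub>x u\<^sub>x\<^sub>x. \<forall>t>0. \<forall>x\<in>{0<..<L}.
        ((\<lambda>s. ?u s x) has_real_derivative u\<^sub>t t x) (at t) \<and>
        (?u t has_real_derivative u\<^sub>x t x) (at x) \<and>
        (u\<^sub>x t has_real_derivative u\<^sub>x\<^sub>x t x) (at x) \<and>
        u\<^sub>t t x = u\<^sub>x\<^sub>x t x"
    by (intro exI[of _ "\<lambda>t x. \<integral>z. gauss_xx t (x - z) * F z \<partial>lborel"]
        exI[of _ "\<lambda>t x. \<integral>z. gauss_x t (x - z) * F z \<partial>lborel"]) simp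
  ultimately show ?thesis unfolding dirichlet_heat_solution_def cl fr by simp
qed

lemma is_dirichlet_heat_kernel_image_kernel:
  assumes L: "L > 0"
  shows "is_dirichlet_heat_kernel {0<..<L} (image_kernel L)"
proof -
  have cl: "closure {0<..<L} = {0..L}" using L by simp
  have fr: "frontier {0<..<L} = {0, L}" using L by (auto simp: frontier_def)
  have "continuous_on ({0<..} \<times> {0..L} \<times> {0..L})
      (\<lambda>p. (\<lambda>(t, z). theta L t z) (fst p, fst (snd p) - snd (snd p)) - (\<lambda>(t, z). theta L t z) (fst p, fst (snd p) + snd (snd p)))"
    by (intro continuous_on_diff continuous_on_compose2[OF continuous_on_theta[OF L]] continuous_intros) auto
  then have "continuous_on ({0<..} \<times> {0..L} \<times> {0..L}) (\<lambda>(t, x, y). image_kernel L t x y)"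
    by (rule continuous_on_eq) (use image_kernel_eq[OF L] in auto)
  moreover have "\<forall>t x y. \<not> (t > 0 \<and> x \<in> {0<..<L} \<and> y \<in> {0<..<L}) \<longrightarrow> image_kernel L t x y = 0"
    by (simp add: image_kernel_def)
  ultimately show ?thesis
    unfolding is_dirichlet_heat_kernel_def cl fr using image_kernel_solution[OF L] by simp
qed

lemma dirichlet_heat_kernel_interval:
  assumes L: "L > 0"
  shows "dirichlet_heat_kernel {0<..<L} = image_kernel L"
  unfolding dirichlet_heat_kernel_def
  using is_dirichlet_heat_kernel_image_kernel[OF L] is_dirichlet_heat_kernel_unique[OF L]
  by (intro the_equality) auto

section \<open>The trace of the kernel and its small-time limit\<close>

lemma dirichlet_partition_function_interval:
  assumes L: "L > 0" and t: "t > 0"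
  shows "dirichlet_partition_function {0<..<L} t = L * theta L t 0 - 1 / 2"
proof -
  define K where "K = (\<lambda>x. theta L t 0 - theta L t (2 * x))"
  have c2: "continuous_on {0..L} (\<lambda>x. theta L t (2 * x))"
    by (intro continuous_on_compose2[OF continuous_on_theta_space[OF L t, of UNIV]] continuous_intros) auto
  then have "continuous_on {0..L} K" unfolding K_def by (intro continuous_intros)
  then have "set_integrable lborel {0..L} K"
    unfolding set_integrable_def by (intro borel_integrable_compact) auto
  then have *: "set_integrable lborel {0<..<L} K" by (rule set_integrable_subset) auto
  have "dirichlet_partition_function {0<..<L} t = (LINT x:{0<..<L}|lborel. K x)"
    unfolding dirichlet_partition_function_def dirichlet_heat_kernel_interval[OF L]
    using t by (intro set_lebesgue_integral_cong) (auto simp: image_kernel_def K_def)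
  also have "\<dots> = integral {0..L} K"
    using set_borel_integral_eq_integral(2)[OF *] by (simp add: integral_open_interval_real)
  also have "\<dots> = L * theta L t 0 - integral {0..L} (\<lambda>x. theta L t (2 * x))"
    unfolding K_def using L by (subst integral_diff) (auto intro!: integrable_continuous_real c2)
  finally show ?thesis by (simp add: integral_theta_double[OF L t])
qed

theorem mainTheorem8:
  fixes L :: real
  assumes "L > 0"
  shows "(\<lambda>t. dirichlet_partition_function {0<..<L} t - (L / sqrt (4 * pi * t) - 1 / 2))
           \<in> o[at_right 0](\<lambda>_. 1)"
proof (rule smalloI_tendsto)
  \<comment> \<open>The trace formula is exact for each \<open>t > 0\<close>, so the whole remainder
    is that of \<open>L * theta L t 0\<close>; the division by 1 is the little-o quotient.\<close>
  have "eventually (\<lambda>t. L * theta L t 0 - L / sqrt (4 * pi * t)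
      = (dirichlet_partition_function {0<..<L} t - (L / sqrt (4 * pi * t) - 1 / 2)) / 1) (at_right 0)"
    using eventually_at_right_less[of "0::real"]
    by eventually_elim (simp add: dirichlet_partition_function_interval[OF assms])
  then show "((\<lambda>t. (dirichlet_partition_function {0<..<L} t - (L / sqrt (4 * pi * t) - 1 / 2)) / 1) \<longlongrightarrow> 0) (at_right 0)"
    using theta_zero_asymptotic[OF assms] by (rule Lim_transform_eventually[rotated])
qed simp

end
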